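(* Let $\Gamma$ be a countable abelian group and let $f \in \mathbb{Z}[\Gamma]$. Suppose that the principal algebraic dynamical system $(X_f,\alpha_f)$ associated with $f$ is expansive and that $X_f$ is connected. Then the dynamical system $(X_f,\alpha_f)$ has the Moore-Myhill property; that is, for every $\Gamma$-equivariant continuous map $\tau \colon X_f \to X_f$ (not assumed to be a group homomorphism), $\tau$ is surjective if and only if $\tau$ is pre-injective.
   Context: Principal algebraic dynamical systems. For a countable group $\Gamma$ (written multiplicatively), $\mathbb{Z}[\Gamma]$ is its integral group ring. Let $\mathbb{T} = \mathbb{R}/\mathbb{Z}$. For $f = \sum_{\gamma} f_\gamma \gamma \in \mathbb{Z}[\Gamma]$, $X_f$ is the Pontryagin dual (a compact metrizable abelian group) of the discrete countable left $\mathbb{Z}[\Gamma]$-module $\mathbb{Z}[\Gamma]/\mathbb{Z}[\Gamma] f$, where $\mathbb{Z}[\Gamma] f$ is the principal left ideal generated by $f$, and $\alpha_f$ is the dual action of $\Gamma$ on $X_f$ by continuous group automorphisms, given by $(\gamma\chi)(m) = \chi(\gamma^{-1} m)$ for $\gamma \in \Gamma$, $\chi \in X_f$, $m \in \mathbb{Z}[\Gamma]/\mathbb{Z}[\Gamma] f$. Equivalently, via the pairing $\langle g,x\rangle = \sum_{\eta \in \Gamma} g_\eta x(\eta)$ between $\mathbb{Z}[\Gamma]$ and $\mathbb{T}^\Gamma$, $$X_f = \{ x \in \mathbb{T}^\Gamma : \sum_{\eta \in \Gamma} f_\eta\, x(\gamma\eta) = 0 \text{ for all } \gamma \in \Gamma\},$$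 with the topology induced by the product topology of $\mathbb{T}^\Gamma$ and with $\alpha_f$ the restriction of the shift action $(\gamma x)(\gamma') = x(\gamma^{-1}\gamma')$. Dynamical notions. Let $(X,\alpha)$ be a dynamical system, i.e. a compact metrizable space $X$ with a continuous action $\alpha$ of a countable group $\Gamma$, and let $d$ be a metric on $X$ compatible with its topology (the following notions do not depend on the choice of $d$). - $(X,\alpha)$ is expansive if there is $\delta > 0$ such that for all distinct $x,y \in X$ there exists $\gamma \in \Gamma$ with $d(\gamma x,\gamma y) \ge \delta$. - Points $x,y \in X$ are homoclinic if for every $\varepsilon>0$ there is a finite set $F \subset \Gamma$ with $d(\gamma x,\gamma y) < \varepsilon$ for all $\gamma \in \Gamma \setminus F$. This is an equivalence relation on $X$, whose classes are called homoclinicity classes. - A map with source set $X$ is pre-injective if its restriction to each homoclinicity class is injective. - An endomorphism of $(X,\alpha)$ is a $\Gamma$-equivariant continuous map $\tau\colon X \to X$. - $(X,\alpha)$ has the Moore property if every surjective endomorphism is pre-injective, the Myhill property if every pre-injective endomorphism is surjective, and the Moore-Myhill property if it has both. *)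

theory Defs
  imports "HOL-Analysis.Analysis" "HOL-Library.Poly_Mapping" "HOL-Library.Countable"
begin

text \<open>
  Groups are written additively, through the type classes \<open>group_add\<close> (which is not assumed
  commutative) and \<open>ab_group_add\<close>.  Under this convention the type
  \<open>'g \<Rightarrow>\<^sub>0 int\<close> of finitely supported functions, with the convolution product of
  \<open>Poly_Mapping\<close>, is the integral group ring of \<open>'g\<close>.
\<close>

section \<open>The circle group\<close>

quotient_type circle = real / "\<lambda>x y :: real. x - y \<in> \<int>"
proof (intro equivpI reflpI sympI transpI)
  fix x y z :: real
  show "x - x \<in> \<int>" by simp
  show "y - x \<in> \<int>" if "x - y \<in> \<int>" using Ints_minus[OF that] by simp
  show "x - z \<in> \<int>" if "x - y \<in> \<int>" "y - z \<in> \<int>" using Ints_add[OF that] by simp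
qed

instantiation circle :: ab_group_add
begin

lift_definition zero_circle :: circle is 0 .

lift_definition plus_circle :: "circle \<Rightarrow> circle \<Rightarrow> circle" is "(+)"
  by (metis Ints_add add_diff_add)

lift_definition uminus_circle :: "circle \<Rightarrow> circle" is uminus
  by (metis Ints_minus minus_diff_minus)

lift_definition minus_circle :: "circle \<Rightarrow> circle \<Rightarrow> circle" is "(-)"
proof -
  fix a b c d :: real
  assume "a - b \<in> \<int>" "c - d \<in> \<int>"
  then have "(a - b) - (c - d) \<in> \<int>" by (rule Ints_diff)
  then show "(a - c) - (b - d) \<in> \<int>" by (simp add: algebra_simps)
qed

instance
  by standard (transfer, simp)+

end

lift_definition int_scale :: "int \<Rightarrow> circle \<Rightarrow> circle" is "\<lambda>n x. of_int n * x"
  by (metis Ints_mult Ints_of_int right_diff_distrib)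

lemma abs_sub_round_le: "\<bar>z - of_int (round z)\<bar> \<le> \<bar>z - w\<bar>" if "w \<in> \<int>" for z w :: real
  using that round_diff_minimal by (auto elim!: Ints_cases)

instantiation circle :: metric_space
begin

text \<open>The distance of two classes is the distance of the difference of representatives to the
  integers.  It induces the quotient topology, see \<open>open_circle_iff\<close>.\<close>

lift_definition dist_circle :: "circle \<Rightarrow> circle \<Rightarrow> real"
  is "\<lambda>x y. \<bar>(x - y) - of_int (round (x - y))\<bar>"
proof -
  have le: "\<bar>(a - c) - of_int (round (a - c))\<bar> \<le> \<bar>(b - d) - of_int (round (b - d))\<bar>"
    if "a - b \<in> \<int>" "c - d \<in> \<int>" for a b c d :: real
  proof -
    have "(a - b) - (c - d) + of_int (round (b - d)) \<in> \<int>"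
      using Ints_add[OF Ints_diff[OF that] Ints_of_int] .
    from abs_sub_round_le[OF this, of "a - c"] show ?thesis by (simp add: algebra_simps)
  qed
  fix a b c d :: real
  assume h: "a - b \<in> \<int>" "c - d \<in> \<int>"
  have h': "b - a \<in> \<int>" "d - c \<in> \<int>" using Ints_minus[OF h(1)] Ints_minus[OF h(2)] by simp_all
  show "\<bar>(a - c) - of_int (round (a - c))\<bar> = \<bar>(b - d) - of_int (round (b - d))\<bar>"
    using le[OF h] le[OF h'] by simp
qed

definition uniformity_circle :: "(circle \<times> circle) filter"
  where "uniformity_circle = (INF e\<in>{0<..}. principal {(x, y). dist x y < e})"

definition open_circle :: "circle set \<Rightarrow> bool"
  where "open_circle U \<longleftrightarrow> (\<forall>x\<in>U. \<forall>\<^sub>F (x', y) in uniformity. x' = x \<longrightarrow> y \<in> U)"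

instance
proof
  show "dist x y = 0 \<longleftrightarrow> x = y" for x y :: circle
  proof transfer
    fix x y :: real
    have "x - y \<in> \<int>" if "\<bar>(x - y) - of_int (round (x - y))\<bar> = 0"
    proof -
      have "x - y = of_int (round (x - y))" using that by simp
      then show ?thesis by (metis Ints_of_int)
    qed
    moreover have "\<bar>(x - y) - of_int (round (x - y))\<bar> = 0" if "x - y \<in> \<int>"
      using abs_sub_round_le[OF that, of "x - y"] by simp
    ultimately show "\<bar>(x - y) - of_int (round (x - y))\<bar> = 0 \<longleftrightarrow> x - y \<in> \<int>" by blast
  qed
  show "dist x y \<le> dist x z + dist y z" for x y z :: circle
  proof transfer
    fix x y z :: real
    have "of_int (round (x - z)) - of_int (round (y - z)) \<in> (\<int> :: real set)" by simp
    from abs_sub_round_le[OF this, of "x - y"]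
    show "\<bar>(x - y) - of_int (round (x - y))\<bar>
      \<le> \<bar>(x - z) - of_int (round (x - z))\<bar> + \<bar>(y - z) - of_int (round (y - z))\<bar>"
      by linarith
  qed
qed (simp_all add: uniformity_circle_def open_circle_def)

end

lemma dist_abs_circle: "dist (abs_circle x) (abs_circle y) = \<bar>(x - y) - of_int (round (x - y))\<bar>"
  by (simp add: dist_circle.abs_eq)

lemma continuous_on_abs_circle: "continuous_on UNIV abs_circle"
proof (rule continuous_on_iff[THEN iffD2], intro ballI allI impI)
  fix x e :: real assume "0 < e"
  moreover have "dist (abs_circle y) (abs_circle x) \<le> dist y x" for y
    using abs_sub_round_le[of 0 "y - x"] by (simp add: dist_abs_circle dist_real_def)
  ultimately show "\<exists>d>0. \<forall>y\<in>UNIV. dist y x < d \<longrightarrow> dist (abs_circle y) (abs_circle x) < e"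
    by (meson le_less_trans)
qed

lemma open_circle_iff: "open U \<longleftrightarrow> open (abs_circle -` U)"
proof
  show "open (abs_circle -` U)" if "open U"
    using that continuous_on_abs_circle by (simp add: open_vimage)
  assume op: "open (abs_circle -` U)"
  show "open U"
    unfolding open_dist
  proof
    fix u assume "u \<in> U"
    obtain x where u: "u = abs_circle x" by (metis Quotient3_abs_rep Quotient3_circle)
    with \<open>u \<in> U\<close> op obtain e where e: "e > 0" "\<And>y. dist y x < e \<Longrightarrow> abs_circle y \<in> U"
      unfolding open_dist by auto
    have "v \<in> U" if v: "dist v u < e" for v
    proof -
      obtain y where y: "v = abs_circle y" by (metis Quotient3_abs_rep Quotient3_circle)
      let ?y = "y - of_int (round (y - x))"
      have "abs_circle ?y = v" unfolding y by (rule circle.abs_eq_iff[THEN iffD2]) simp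
      moreover have "dist ?y x < e"
        using v by (simp add: u y dist_abs_circle dist_real_def algebra_simps)
      ultimately show ?thesis using e(2) by metis
    qed
    then show "\<exists>e>0. \<forall>v. dist v u < e \<longrightarrow> v \<in> U" using e(1) by blast
  qed
qed


lemma compact_UNIV_circle: "compact (UNIV :: circle set)"
proof -
  have "UNIV = abs_circle ` {0..1}"
  proof (intro equalityI subsetI)
    fix u
    obtain x where u: "u = abs_circle x" by (metis Quotient3_abs_rep Quotient3_circle)
    have "abs_circle (frac x) = u"
      unfolding u by (rule circle.abs_eq_iff[THEN iffD2]) (simp add: frac_def)
    moreover have "frac x \<in> {0..1}" using frac_ge_0 frac_lt_1[of x] by (auto intro: less_imp_le)
    ultimately show "u \<in> abs_circle ` {0..1}" by blast
  qed simp
  moreover have "compact (abs_circle ` {0..1})"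
    by (intro compact_continuous_image continuous_on_subset[OF continuous_on_abs_circle]) auto
  ultimately show ?thesis by simp
qed

lemma dist_circle_add_le:
  fixes a b c d :: circle
  shows "dist (a + c) (b + d) \<le> dist a b + dist c d"
proof transfer
  fix a b c d :: real
  have "of_int (round (a - b)) + of_int (round (c - d)) \<in> (\<int> :: real set)" by simp
  from abs_sub_round_le[OF this, of "(a + c) - (b + d)"]
  show "\<bar>(a + c) - (b + d) - of_int (round ((a + c) - (b + d)))\<bar>
    \<le> \<bar>(a - b) - of_int (round (a - b))\<bar> + \<bar>(c - d) - of_int (round (c - d))\<bar>"
    by linarith
qed

lemma dist_circle_minus: "dist (- a) (- b) = dist a b" for a b :: circle
proof -
  have "dist (- x) (- y) \<le> dist x y" for x y :: circle
    using dist_circle_add_le[of y "- x - y" x "- x - y"]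
    by (simp add: dist_commute)
  from this[of a b] this[of "- a" "- b"] show ?thesis by simp
qed

instance circle :: topological_ab_group_add
proof
  fix a b :: circle
  show "((\<lambda>x. fst x + snd x) \<longlongrightarrow> a + b) (nhds a \<times>\<^sub>F nhds b)"
  proof (rule tendstoI)
    fix e :: real assume e: "0 < e"
    have "\<forall>\<^sub>F x in nhds a. dist x a < e / 2" "\<forall>\<^sub>F x in nhds b. dist x b < e / 2"
      using e half_gt_zero unfolding eventually_nhds_metric by blast+
    then have "\<forall>\<^sub>F x in nhds a \<times>\<^sub>F nhds b. dist (fst x) a < e / 2 \<and> dist (snd x) b < e / 2"
      by (auto simp: eventually_prod_filter)
    then show "\<forall>\<^sub>F x in nhds a \<times>\<^sub>F nhds b. dist (fst x + snd x) (a + b) < e"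
    proof eventually_elim
      case (elim x)
      then show ?case using dist_circle_add_le[of "fst x" "snd x" a b] by linarith
    qed
  qed
  show "(uminus \<longlongrightarrow> - a) (nhds a)"
  proof (rule tendstoI)
    fix e :: real assume "0 < e"
    then have "\<forall>\<^sub>F x in nhds a. dist x a < e" by (auto simp: eventually_nhds_metric)
    then show "\<forall>\<^sub>F x in nhds a. dist (- x) (- a) < e"
      by (simp add: dist_circle_minus)
  qed
qed

lemma continuous_on_int_scale: "continuous_on A (int_scale n)"
proof -
  have add: "int_scale (m + 1) = (\<lambda>x. int_scale m x + x)" for m
    by (rule ext, transfer) (simp add: distrib_right)
  have diff: "int_scale (m - 1) = (\<lambda>x. int_scale m x - x)" for m
    by (rule ext, transfer) (simp add: left_diff_distrib)
  have zero: "int_scale 0 = (\<lambda>x. 0)"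
    by (rule ext, transfer) simp
  show ?thesis
    by (induction n rule: int_induct[where k = 0])
      (auto simp: add diff zero intro!: continuous_intros)
qed


section \<open>Principal algebraic dynamical systems\<close>

text \<open>Function types carry the product topology.\<close>

definition shift :: "'g :: group_add \<Rightarrow> ('g \<Rightarrow> 'a) \<Rightarrow> 'g \<Rightarrow> 'a" where
  "shift \<gamma> x = (\<lambda>\<gamma>'. x (- \<gamma> + \<gamma>'))"

definition pairing :: "('g \<Rightarrow>\<^sub>0 int) \<Rightarrow> ('g \<Rightarrow> circle) \<Rightarrow> circle" where
  "pairing g x = (\<Sum>\<eta>\<in>Poly_Mapping.keys g. int_scale (Poly_Mapping.lookup g \<eta>) (x \<eta>))"

definition principal_system :: "('g :: group_add \<Rightarrow>\<^sub>0 int) \<Rightarrow> ('g \<Rightarrow> circle) set" where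
  "principal_system f = {x. \<forall>\<gamma>. (\<Sum>\<eta>\<in>Poly_Mapping.keys f.
     int_scale (Poly_Mapping.lookup f \<eta>) (x (\<gamma> + \<eta>))) = 0}"


section \<open>Dynamical notions\<close>

text \<open>A dynamical system is given by a set \<open>X\<close> in a topological space, a metric \<open>d\<close> on \<open>X\<close>
  compatible with the subspace topology, and an action \<open>\<alpha>\<close> on \<open>X\<close>.  For compact \<open>X\<close> the notions below do
  not depend on the choice of \<open>d\<close>.  A map on \<open>X\<close> is a
  total function whose values outside \<open>X\<close> are irrelevant.\<close>

definition compatible_metric ::
  "'x :: topological_space set \<Rightarrow> ('x \<Rightarrow> 'x \<Rightarrow> real) \<Rightarrow> bool" where
  "compatible_metric X d \<longleftrightarrow>
     Metric_space X d \<and> Metric_space.mtopology X d = top_of_set X"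

definition expansive ::
  "'x set \<Rightarrow> ('x \<Rightarrow> 'x \<Rightarrow> real) \<Rightarrow> ('g \<Rightarrow> 'x \<Rightarrow> 'x) \<Rightarrow> bool" where
  "expansive X d \<alpha> \<longleftrightarrow>
     (\<exists>\<delta>>0. \<forall>x\<in>X. \<forall>y\<in>X. x \<noteq> y \<longrightarrow> (\<exists>\<gamma>. d (\<alpha> \<gamma> x) (\<alpha> \<gamma> y) \<ge> \<delta>))"

definition homoclinic ::
  "('x \<Rightarrow> 'x \<Rightarrow> real) \<Rightarrow> ('g \<Rightarrow> 'x \<Rightarrow> 'x) \<Rightarrow> 'x \<Rightarrow> 'x \<Rightarrow> bool" where
  "homoclinic d \<alpha> x y \<longleftrightarrow>
     (\<forall>\<epsilon>>0. \<exists>F. finite F \<and> (\<forall>\<gamma>. \<gamma> \<notin> F \<longrightarrow> d (\<alpha> \<gamma> x) (\<alpha> \<gamma> y) < \<epsilon>))"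

definition pre_injective ::
  "'x set \<Rightarrow> ('x \<Rightarrow> 'x \<Rightarrow> real) \<Rightarrow> ('g \<Rightarrow> 'x \<Rightarrow> 'x) \<Rightarrow> ('x \<Rightarrow> 'y) \<Rightarrow> bool" where
  "pre_injective X d \<alpha> \<tau> \<longleftrightarrow> (\<forall>x\<in>X. inj_on \<tau> {y \<in> X. homoclinic d \<alpha> x y})"

definition endomorphism ::
  "'x :: topological_space set \<Rightarrow> ('g \<Rightarrow> 'x \<Rightarrow> 'x) \<Rightarrow> ('x \<Rightarrow> 'x) \<Rightarrow> bool" where
  "endomorphism X \<alpha> \<tau> \<longleftrightarrow>
     \<tau> \<in> X \<rightarrow> X \<and> continuous_on X \<tau> \<and> (\<forall>\<gamma>. \<forall>x\<in>X. \<tau> (\<alpha> \<gamma> x) = \<alpha> \<gamma> (\<tau> x))"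

definition Moore_property ::
  "'x :: topological_space set \<Rightarrow> ('x \<Rightarrow> 'x \<Rightarrow> real) \<Rightarrow> ('g \<Rightarrow> 'x \<Rightarrow> 'x) \<Rightarrow> bool" where
  "Moore_property X d \<alpha> \<longleftrightarrow>
     (\<forall>\<tau>. endomorphism X \<alpha> \<tau> \<longrightarrow> \<tau> ` X = X \<longrightarrow> pre_injective X d \<alpha> \<tau>)"

definition Myhill_property ::
  "'x :: topological_space set \<Rightarrow> ('x \<Rightarrow> 'x \<Rightarrow> real) \<Rightarrow> ('g \<Rightarrow> 'x \<Rightarrow> 'x) \<Rightarrow> bool" where
  "Myhill_property X d \<alpha> \<longleftrightarrow>
     (\<forall>\<tau>. endomorphism X \<alpha> \<tau> \<longrightarrow> pre_injective X d \<alpha> \<tau> \<longrightarrow> \<tau> ` X = X)"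

definition Moore_Myhill_property ::
  "'x :: topological_space set \<Rightarrow> ('x \<Rightarrow> 'x \<Rightarrow> real) \<Rightarrow> ('g \<Rightarrow> 'x \<Rightarrow> 'x) \<Rightarrow> bool" where
  "Moore_Myhill_property X d \<alpha> \<longleftrightarrow> Moore_property X d \<alpha> \<and> Myhill_property X d \<alpha>"


section \<open>Sanity checks\<close>

subsection \<open>The system is the Pontryagin dual of the quotient by the principal left ideal\<close>

lemma int_scale_0 [simp]: "int_scale 0 x = 0"
  by transfer simp

lemma int_scale_1 [simp]: "int_scale 1 x = x"
  by transfer simp

lemma int_scale_add: "int_scale (m + n) x = int_scale m x + int_scale n x"
  by transfer (simp add: distrib_right)

lemma int_scale_mult: "int_scale (m * n) x = int_scale m (int_scale n x)"
  by transfer (simp add: mult.assoc)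

lemma pairing_superset:
  assumes "finite A" "Poly_Mapping.keys g \<subseteq> A"
  shows "pairing g x = (\<Sum>\<eta>\<in>A. int_scale (Poly_Mapping.lookup g \<eta>) (x \<eta>))"
  unfolding pairing_def using assms
  by (intro sum.mono_neutral_left) (auto simp: in_keys_iff)

lemma pairing_add: "pairing (g + h) x = pairing g x + pairing h x"
proof -
  let ?A = "Poly_Mapping.keys g \<union> Poly_Mapping.keys h"
  have A: "finite ?A" by simp
  have "Poly_Mapping.keys (g + h) \<subseteq> ?A" by (rule keys_add)
  then show ?thesis
    by (simp add: pairing_superset[OF A] lookup_add int_scale_add sum.distrib)
qed

lemma pairing_single: "pairing (Poly_Mapping.single \<gamma> n) x = int_scale n (x \<gamma>)"
  by (simp add: pairing_def)

lemma additive_0: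
  fixes \<xi> :: "'a :: ab_group_add \<Rightarrow> 'b :: ab_group_add"
  assumes "\<And>a b. \<xi> (a + b) = \<xi> a + \<xi> b"
  shows "\<xi> 0 = 0"
  using assms[of 0 0] by (metis add_cancel_right_left add.right_neutral)

lemma additive_single:
  fixes \<xi> :: "('g \<Rightarrow>\<^sub>0 int) \<Rightarrow> circle"
  assumes add: "\<And>a b. \<xi> (a + b) = \<xi> a + \<xi> b"
  shows "\<xi> (Poly_Mapping.single \<gamma> n) = int_scale n (\<xi> (Poly_Mapping.single \<gamma> 1))"
proof (induction n rule: int_induct[where k = 0])
  case base
  then show ?case by (simp add: additive_0[of \<xi>, OF add])
next
  case (step1 i)
  then show ?case by (simp add: single_add add int_scale_add)
next
  case (step2 i)
  have "\<xi> (Poly_Mapping.single \<gamma> i) = \<xi> (Poly_Mapping.single \<gamma> (i - 1) + Poly_Mapping.single \<gamma> 1)"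
    by (simp flip: single_add)
  moreover have "int_scale i (\<xi> (Poly_Mapping.single \<gamma> 1)) =
      int_scale (i - 1) (\<xi> (Poly_Mapping.single \<gamma> 1)) + \<xi> (Poly_Mapping.single \<gamma> 1)"
    using int_scale_add[of "i - 1" 1] by simp
  ultimately show ?case using step2 by (simp add: add)
qed

lemma additive_sum:
  fixes \<xi> :: "'a :: ab_group_add \<Rightarrow> 'b :: ab_group_add"
  assumes add: "\<And>a b. \<xi> (a + b) = \<xi> a + \<xi> b"
  shows "\<xi> (sum u A) = (\<Sum>i\<in>A. \<xi> (u i))"
  by (induction A rule: infinite_finite_induct) (simp_all add: add additive_0[of \<xi>, OF add])

lemma sum_singles: "(\<Sum>\<eta>\<in>Poly_Mapping.keys g. Poly_Mapping.single \<eta> (Poly_Mapping.lookup g \<eta>)) = g"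
  by (rule poly_mapping_eqI)
    (auto simp: lookup_sum lookup_single when_def in_keys_iff)

lemma additive_eq_pairing:
  fixes \<xi> :: "('g \<Rightarrow>\<^sub>0 int) \<Rightarrow> circle"
  assumes add: "\<And>a b. \<xi> (a + b) = \<xi> a + \<xi> b"
  shows "\<xi> g = pairing g (\<lambda>\<gamma>. \<xi> (Poly_Mapping.single \<gamma> 1))"
proof -
  have "\<xi> g = \<xi> (\<Sum>\<eta>\<in>Poly_Mapping.keys g. Poly_Mapping.single \<eta> (Poly_Mapping.lookup g \<eta>))"
    by (simp add: sum_singles)
  also have "\<dots> = pairing g (\<lambda>\<gamma>. \<xi> (Poly_Mapping.single \<gamma> 1))"
    unfolding pairing_def additive_sum[of \<xi>, OF add]
    by (intro sum.cong refl additive_single add)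
  finally show ?thesis .
qed

lemma pairing_translate:
  fixes f :: "'g :: group_add \<Rightarrow>\<^sub>0 int"
  shows "pairing (Poly_Mapping.single \<gamma> n * f) x =
    int_scale n (\<Sum>\<eta>\<in>Poly_Mapping.keys f. int_scale (Poly_Mapping.lookup f \<eta>) (x (\<gamma> + \<eta>)))"
proof -
  have scale_add: "int_scale n (a + b) = int_scale n a + int_scale n b" for a b
    by transfer (simp add: distrib_left)
  have "pairing (Poly_Mapping.single \<gamma> n * f) x = pairing (Poly_Mapping.single \<gamma> n *
      (\<Sum>\<eta>\<in>Poly_Mapping.keys f. Poly_Mapping.single \<eta> (Poly_Mapping.lookup f \<eta>))) x"
    by (simp add: sum_singles)
  also have "\<dots> = (\<Sum>\<eta>\<in>Poly_Mapping.keys f.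
      pairing (Poly_Mapping.single (\<gamma> + \<eta>) (n * Poly_Mapping.lookup f \<eta>)) x)"
    by (simp add: sum_distrib_left mult_single additive_sum[of "\<lambda>g. pairing g x", OF pairing_add])
  also have "\<dots> = (\<Sum>\<eta>\<in>Poly_Mapping.keys f.
      int_scale n (int_scale (Poly_Mapping.lookup f \<eta>) (x (\<gamma> + \<eta>))))"
    by (simp add: pairing_single int_scale_mult)
  also have "\<dots> = int_scale n (\<Sum>\<eta>\<in>Poly_Mapping.keys f.
      int_scale (Poly_Mapping.lookup f \<eta>) (x (\<gamma> + \<eta>)))"
    by (rule additive_sum[of "int_scale n", OF scale_add, symmetric])
  finally show ?thesis .
qed

lemma principal_system_iff: "x \<in> principal_system f \<longleftrightarrow> (\<forall>g. pairing (g * f) x = 0)"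
proof
  assume x: "x \<in> principal_system f"
  have scale_0: "int_scale n 0 = 0" for n by transfer simp
  have "pairing (g * f) x = 0" for g
  proof -
    have "pairing (g * f) x = pairing ((\<Sum>\<gamma>\<in>Poly_Mapping.keys g.
        Poly_Mapping.single \<gamma> (Poly_Mapping.lookup g \<gamma>)) * f) x"
      by (simp add: sum_singles)
    also have "\<dots> = (\<Sum>\<gamma>\<in>Poly_Mapping.keys g.
        pairing (Poly_Mapping.single \<gamma> (Poly_Mapping.lookup g \<gamma>) * f) x)"
      by (simp add: sum_distrib_right additive_sum[of "\<lambda>g. pairing g x", OF pairing_add])
    also have "\<dots> = 0"
      using x by (simp add: pairing_translate principal_system_def scale_0)
    finally show ?thesis .
  qed
  then show "\<forall>g. pairing (g * f) x = 0" by blast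
next
  assume "\<forall>g. pairing (g * f) x = 0"
  then have "pairing (Poly_Mapping.single \<gamma> 1 * f) x = 0" for \<gamma> by blast
  then show "x \<in> principal_system f"
    by (simp add: pairing_translate principal_system_def)
qed

definition dual_of_quotient :: "('g :: group_add \<Rightarrow>\<^sub>0 int) \<Rightarrow> (('g \<Rightarrow>\<^sub>0 int) \<Rightarrow> circle) set" where
  "dual_of_quotient f = {\<xi>. (\<forall>a b. \<xi> (a + b) = \<xi> a + \<xi> b) \<and> (\<forall>g. \<xi> (g * f) = 0)}"

text \<open>Characters of the quotient module are the additive maps on the group ring which vanish on
  the left ideal of all \<open>g * f\<close>.\<close>

lemma continuous_on_pairing: "continuous_on A (pairing g)"
proof -
  have "continuous_on A (\<lambda>x. int_scale n (x \<eta>))" for n \<eta>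
    by (rule continuous_on_compose2[OF continuous_on_int_scale])
      (auto intro: continuous_on_subset[OF continuous_on_product_coordinates])
  then show ?thesis unfolding pairing_def[abs_def] by (intro continuous_on_sum)
qed

lemma homeomorphism_dual_principal_system:
  "homeomorphism (dual_of_quotient f) (principal_system f)
     (\<lambda>\<xi> \<gamma>. \<xi> (Poly_Mapping.single \<gamma> 1)) (\<lambda>x g. pairing g x)"
proof (rule homeomorphismI)
  show "continuous_on (dual_of_quotient f) (\<lambda>\<xi> \<gamma>. \<xi> (Poly_Mapping.single \<gamma> 1))"
    by (intro continuous_on_coordinatewise_then_product)
      (rule continuous_on_subset[OF continuous_on_product_coordinates], simp)
  show "continuous_on (principal_system f) (\<lambda>x g. pairing g x)"
    by (intro continuous_on_coordinatewise_then_product continuous_on_pairing)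
  show "(\<lambda>\<xi> \<gamma>. \<xi> (Poly_Mapping.single \<gamma> 1)) ` dual_of_quotient f \<subseteq> principal_system f"
  proof (rule image_subsetI)
    fix \<xi> assume "\<xi> \<in> dual_of_quotient f"
    then have add: "\<xi> (a + b) = \<xi> a + \<xi> b" and zero: "\<xi> (g * f) = 0" for a b g
      by (auto simp: dual_of_quotient_def)
    from zero show "(\<lambda>\<gamma>. \<xi> (Poly_Mapping.single \<gamma> 1)) \<in> principal_system f"
      by (simp add: principal_system_iff additive_eq_pairing[of \<xi>, OF add, symmetric])
  qed
  show "(\<lambda>x g. pairing g x) ` principal_system f \<subseteq> dual_of_quotient f"
    by (auto simp: dual_of_quotient_def pairing_add principal_system_iff)
  show "(\<lambda>g. pairing g (\<lambda>\<gamma>. \<xi> (Poly_Mapping.single \<gamma> 1))) = \<xi>" if "\<xi> \<in> dual_of_quotient f" for \<xi>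
    using that by (intro ext additive_eq_pairing[symmetric]) (simp add: dual_of_quotient_def)
  show "(\<lambda>\<gamma>. pairing (Poly_Mapping.single \<gamma> 1) x) = x" if "x \<in> principal_system f" for x
    by (simp add: pairing_single)
qed

lemma dual_action_shift:
  "(\<lambda>\<gamma>'. (\<lambda>m. \<xi> (Poly_Mapping.single (- \<gamma>) 1 * m)) (Poly_Mapping.single \<gamma>' 1)) =
     shift \<gamma> (\<lambda>\<gamma>'. \<xi> (Poly_Mapping.single \<gamma>' (1 :: int)))"
  by (simp add: shift_def mult_single)

subsection \<open>The system is a compact metrizable dynamical system\<close>

lemma compatible_metric_dist: "compatible_metric X dist"
  for X :: "'x :: metric_space set"
proof -
  interpret Submetric "UNIV :: 'x set" dist X
    by unfold_locales simp
  show ?thesis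
    unfolding compatible_metric_def
    using sub.Metric_space_axioms mtopology_submetric by simp
qed

lemma shift_principal_system:
  fixes f :: "'g :: group_add \<Rightarrow>\<^sub>0 int"
  assumes "x \<in> principal_system f"
  shows "shift \<gamma> x \<in> principal_system f"
proof -
  have "- \<gamma> + (\<gamma>' + \<eta>) = (- \<gamma> + \<gamma>') + \<eta>" for \<gamma>' \<eta> by (simp add: add.assoc)
  then show ?thesis using assms by (simp add: principal_system_def shift_def)
qed

lemma shift_0: "shift 0 x = x"
  by (simp add: shift_def)

lemma shift_add: "shift (\<gamma> + \<gamma>') x = shift \<gamma> (shift \<gamma>' x)"
  by (simp add: shift_def minus_add add.assoc del: add_uminus_conv_diff)

lemma continuous_on_shift: "continuous_on UNIV (shift \<gamma> :: ('g :: group_add \<Rightarrow> circle) \<Rightarrow> _)"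
  unfolding shift_def by (intro continuous_on_coordinatewise_then_product) simp

lemma compact_principal_system: "compact (principal_system f)"
proof -
  have "compact (UNIV :: ('g \<Rightarrow> circle) set)"
    using compact_UNIV_circle compact_space_product_topology[of "\<lambda>_ :: 'g. euclidean :: circle topology" UNIV]
    by (simp add: euclidean_product_topology compact_space_def)
  moreover have "principal_system f = (\<Inter>g. pairing (g * f) -` {0})"
    by (auto simp: principal_system_iff)
  then have "closed (principal_system f)"
    by (auto intro!: closed_vimage continuous_on_pairing)
  ultimately show ?thesis
    using compact_Int_closed by fastforce
qed

end

theory Submission
  imports Defs "HOL-Library.Function_Algebras"
begin

text \<open>
  Write \<open>X\<close> for the system of \<open>f\<close> and let the group ring act on configurations, circle-valued or real,
  by \<open>(g \<cdot> x) \<gamma> = (\<Sum>\<eta>. g \<eta> * x (\<gamma> + \<eta>))\<close>; then \<open>X\<close> is the kernel of \<open>f\<close> on circle-valued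
  configurations, and every \<open>g\<close> acts on \<open>X\<close> because the group is abelian.

  Expansiveness says that \<open>f\<close> kills no nonzero bounded real configuration: a small multiple of such a
  configuration, reduced modulo 1, would be a nonzero point of \<open>X\<close> all of whose translates stay close
  to \<open>0\<close> (\<open>expansive_imp_bounded_injective\<close>). Since \<open>X\<close> is connected, this forces every endomorphism \<open>\<tau>\<close> to be affine
  (\<open>endomorphism_affine\<close>). Indeed, for fixed \<open>y\<close> each coordinate of \<open>\<tau> (x + y) - \<tau> x\<close> lifts to a
  continuous real function of \<open>x\<close>: this is clear for small \<open>y\<close>, the property passes to sums, and the
  connected group \<open>X\<close> is generated by any neighbourhood of \<open>0\<close>; compactness bounds the lifts uniformly,
  and equivariance carries the bound to all coordinates. Applying \<open>f\<close> to the family of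
  lifts gives integer-valued continuous functions of \<open>x\<close>, which are constant. Hence \<open>f\<close> kills the
  bounded variation of the lifts in \<open>x\<close>, so this variation is zero, and \<open>\<tau> (x + y) - \<tau> x\<close> does not
  depend on \<open>x\<close>.

  A compactness argument turns injectivity on bounded configurations into a local estimate
  (\<open>local_control\<close>), which yields a solution \<open>w\<close> of \<open>f w = \<delta>\<^sub>0\<close> that is bounded and tends to
  zero at infinity (\<open>fundamental_solution\<close>). Its reduction \<open>z\<close> modulo 1 is the fundamental homoclinic
  point: the points of \<open>X\<close> homoclinic to \<open>0\<close> are exactly the \<open>g \<cdot> z\<close>, they are dense in \<open>X\<close>, and
  \<open>g \<cdot> z = 0\<close> holds only if \<open>g\<close> is a multiple of \<open>f\<close>. A continuous equivariant homomorphism \<open>\<theta>\<close>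
  of \<open>X\<close> maps \<open>z\<close> to a homoclinic point \<open>r \<cdot> z\<close>, hence equals \<open>r\<close> on all of \<open>X\<close> by density.

  It remains to compare surjectivity of \<open>r\<close> on \<open>X\<close> with its injectivity on the homoclinic points. If
  \<open>r\<close> is onto and \<open>r \<cdot> g \<cdot> z = 0\<close>, then \<open>r * g\<close> kills the homoclinic points, hence \<open>X\<close> by density, so
  \<open>g\<close> kills \<open>r \<cdot> X = X\<close>, in particular \<open>z\<close>. Conversely, if \<open>r\<close> is injective on the homoclinic points,
  then multiplication by \<open>r\<close> is injective on the group ring modulo \<open>f\<close>; a point \<open>x\<close> of \<open>X\<close> is a
  character of this quotient, its transport along multiplication by \<open>r\<close> is defined on the
  multiples of \<open>r\<close>, and an extension to the whole quotient, which exists since the circle is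
  divisible, is a preimage of \<open>x\<close> under \<open>r\<close>.
\<close>

section \<open>The group ring acting on configurations\<close>

text \<open>The scalar multiplication is a parameter, so that one theory covers circle-valued configurations, on
  which \<open>f\<close> defines the system, and their real-valued lifts.\<close>

definition act :: "('r::comm_ring_1 \<Rightarrow> 'a::ab_group_add \<Rightarrow> 'a) \<Rightarrow> ('g::ab_group_add \<Rightarrow>\<^sub>0 'r)
    \<Rightarrow> ('g \<Rightarrow> 'a) \<Rightarrow> 'g \<Rightarrow> 'a"
  where "act s g x = (\<lambda>\<gamma>. \<Sum>\<eta>\<in>Poly_Mapping.keys g. s (Poly_Mapping.lookup g \<eta>) (x (\<gamma> + \<eta>)))"

lemma additive_maps_eqI:
  fixes F G :: "('g \<Rightarrow>\<^sub>0 'r::ab_group_add) \<Rightarrow> 'b::ab_group_add"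
  assumes "\<And>a b. F (a + b) = F a + F b" "\<And>a b. G (a + b) = G a + G b"
    and "\<And>a r. F (Poly_Mapping.single a r) = G (Poly_Mapping.single a r)"
  shows "F g = G g"
proof -
  have "F (\<Sum>\<eta>\<in>Poly_Mapping.keys g. Poly_Mapping.single \<eta> (Poly_Mapping.lookup g \<eta>)) =
      G (\<Sum>\<eta>\<in>Poly_Mapping.keys g. Poly_Mapping.single \<eta> (Poly_Mapping.lookup g \<eta>))"
    using assms by (simp add: additive_sum)
  moreover have "(\<Sum>\<eta>\<in>Poly_Mapping.keys g. Poly_Mapping.single \<eta> (Poly_Mapping.lookup g \<eta>)) = g"
    by (rule poly_mapping_eqI) (auto simp: lookup_sum lookup_single when_def in_keys_iff)
  ultimately show ?thesis by simp
qed

context module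
begin

lemma act_superset:
  assumes "finite A" "Poly_Mapping.keys g \<subseteq> A"
  shows "act scale g x \<gamma> = (\<Sum>\<eta>\<in>A. scale (Poly_Mapping.lookup g \<eta>) (x (\<gamma> + \<eta>)))"
  unfolding act_def using assms
  by (intro sum.mono_neutral_left) (auto simp: in_keys_iff)

lemma act_add_left: "act scale (g + h) x = act scale g x + act scale h x"
proof
  fix \<gamma>
  let ?A = "Poly_Mapping.keys g \<union> Poly_Mapping.keys h"
  have A: "finite ?A" by simp
  have "Poly_Mapping.keys (g + h) \<subseteq> ?A" by (rule keys_add)
  then show "act scale (g + h) x \<gamma> = (act scale g x + act scale h x) \<gamma>"
    by (simp add: act_superset[OF A] lookup_add scale_left_distrib sum.distrib)
qed

lemma act_single: "act scale (Poly_Mapping.single a r) x \<gamma> = scale r (x (\<gamma> + a))"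
  by (simp add: act_def)

lemma act_add: "act scale g (x + y) = act scale g x + act scale g y"
  by (rule ext) (simp add: act_def scale_right_distrib sum.distrib)

lemma act_diff: "act scale g (x - y) = act scale g x - act scale g y"
  by (rule ext) (simp add: act_def scale_right_diff_distrib sum_subtractf)

lemma act_zero [simp]: "act scale g 0 = 0"
  by (rule ext) (simp add: act_def)

text \<open>This makes configurations a module over the group ring; both sides are additive in each of the two
  factors, which reduces the claim to group elements.\<close>

lemma act_mult: "act scale (g * h) x = act scale g (act scale h x)"
proof -
  have single: "act scale (Poly_Mapping.single a r * h) x =
      act scale (Poly_Mapping.single a r) (act scale h x)" for a r
    by (rule additive_maps_eqI[where g = h])
      (auto simp: distrib_left act_add_left act_add mult_single act_single add.assoc fun_eq_iff
        scale_right_distrib)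
  show ?thesis
    by (rule additive_maps_eqI[where g = g])
      (auto simp: distrib_right act_add_left single)
qed

lemma act_commute: "act scale g (act scale h x) = act scale h (act scale g x)"
  by (metis act_mult mult.commute)

end

lemma act_shift: "act s g (shift a x) = shift a (act s g x)"
  by (simp add: act_def shift_def algebra_simps)

lemma shift_diff_fun: "shift a (x - y) = shift a x - shift a (y :: _ \<Rightarrow> 'a::ab_group_add)"
  by (rule ext) (simp add: shift_def)

lemma shift_add_fun: "shift a (x + y) = shift a x + shift a (y :: _ \<Rightarrow> 'a::ab_group_add)"
  by (rule ext) (simp add: shift_def)

lemma shift_zero_fun [simp]: "shift a (0 :: _ \<Rightarrow> 'a::ab_group_add) = 0"
  by (rule ext) (simp add: shift_def)

text \<open>The group ring has integer coefficients, so the line is needed as a module over the integers.\<close>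

definition real_scale :: "int \<Rightarrow> real \<Rightarrow> real"
  where "real_scale n r = of_int n * r"

interpretation circle: module int_scale
proof
  show "int_scale a (x + y) = int_scale a x + int_scale a y" for a x y
    by transfer (simp add: distrib_left)
  show "int_scale (a + b) x = int_scale a x + int_scale b x" for a b x
    by (rule int_scale_add)
qed (simp_all add: int_scale_mult)

interpretation real: module real_scale
  by standard (simp_all add: real_scale_def algebra_simps)

abbreviation torus_act (infixr "\<cdot>" 75) where "g \<cdot> x \<equiv> act int_scale g x"
abbreviation real_act (infixr "\<star>" 75) where "g \<star> v \<equiv> act real_scale g v"

lemma mem_principal_system: "x \<in> principal_system f \<longleftrightarrow> f \<cdot> x = 0"
  by (simp add: principal_system_def act_def fun_eq_iff)

lemma principal_system_zero:
  fixes f :: "'g::ab_group_add \<Rightarrow>\<^sub>0 int"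
  shows "0 \<in> principal_system f"
  by (simp add: mem_principal_system)

lemma principal_system_add:
  fixes f :: "'g::ab_group_add \<Rightarrow>\<^sub>0 int"
  shows "x \<in> principal_system f \<Longrightarrow> y \<in> principal_system f \<Longrightarrow> x + y \<in> principal_system f"
  by (simp add: mem_principal_system circle.act_add)

lemma principal_system_diff:
  fixes f :: "'g::ab_group_add \<Rightarrow>\<^sub>0 int"
  shows "x \<in> principal_system f \<Longrightarrow> y \<in> principal_system f \<Longrightarrow> x - y \<in> principal_system f"
  by (simp add: mem_principal_system circle.act_diff)

lemma principal_system_act: "x \<in> principal_system f \<Longrightarrow> g \<cdot> x \<in> principal_system f"
  by (simp add: mem_principal_system circle.act_commute[of f g])

lemma pairing_eq_act: "pairing g x = (g \<cdot> x) 0"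
  by (simp add: pairing_def act_def)

section \<open>Lifting from the circle to the line\<close>

definition proj :: "('g \<Rightarrow> real) \<Rightarrow> 'g \<Rightarrow> circle"
  where "proj v = (\<lambda>\<gamma>. abs_circle (v \<gamma>))"

lemma abs_circle_add: "abs_circle (a + b) = abs_circle a + abs_circle b"
  by (simp add: plus_circle.abs_eq)

lemma abs_circle_real_scale: "abs_circle (real_scale n a) = int_scale n (abs_circle a)"
  by (simp add: int_scale.abs_eq real_scale_def)

lemma abs_circle_0 [simp]: "abs_circle 0 = 0"
  by (simp add: zero_circle_def)

lemma abs_circle_eq_0_iff: "abs_circle a = 0 \<longleftrightarrow> a \<in> \<int>"
  using circle.abs_eq_iff[of a 0] by simp

lemma abs_circle_sum: "abs_circle (sum u A) = (\<Sum>i\<in>A. abs_circle (u i))"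
  by (rule additive_sum) (rule abs_circle_add)

lemma proj_act: "proj (g \<star> v) = g \<cdot> proj v"
  by (rule ext) (simp add: proj_def act_def abs_circle_sum abs_circle_real_scale)

text \<open>The representative in \<open>[-1/2, 1/2]\<close>, whose absolute value is the distance to \<open>0\<close>.\<close>

definition small_rep :: "circle \<Rightarrow> real"
  where "small_rep u = rep_circle u - of_int (round (rep_circle u))"

lemma abs_circle_small_rep [simp]: "abs_circle (small_rep u) = u"
proof -
  have "abs_circle (small_rep u) = abs_circle (rep_circle u)"
    by (rule circle.abs_eq_iff[THEN iffD2]) (simp add: small_rep_def)
  then show ?thesis by (metis Quotient3_abs_rep Quotient3_circle)
qed

lemma proj_small_rep [simp]: "proj (\<lambda>\<gamma>. small_rep (x \<gamma>)) = x"
  by (simp add: proj_def)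

lemma abs_small_rep: "\<bar>small_rep u\<bar> = dist u 0"
proof -
  have "dist u 0 = dist (abs_circle (rep_circle u)) (abs_circle 0)"
    by (metis Quotient3_abs_rep Quotient3_circle abs_circle_0)
  also have "\<dots> = \<bar>small_rep u\<bar>"
    unfolding dist_abs_circle small_rep_def by simp
  finally show ?thesis by simp
qed

lemma abs_small_rep_le: "\<bar>small_rep u\<bar> \<le> 1"
  using of_int_round_abs_le[of "rep_circle u"] by (simp add: small_rep_def abs_minus_commute)

lemma dist_abs_circle_le: "dist (abs_circle a) (abs_circle b) \<le> \<bar>a - b\<bar>"
  using abs_sub_round_le[of 0 "a - b"] by (simp add: dist_abs_circle)

lemma dist_circle_eq: "dist a b = dist (a - b) (0::circle)"
  by transfer simp

text \<open>Near \<open>0\<close> the representative is an isometry, hence a continuous local section of the projection.\<close>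

lemma abs_small_rep_diff:
  assumes "dist u 0 < 1/4" "dist v 0 < 1/4"
  shows "\<bar>small_rep u - small_rep v\<bar> = dist u v"
proof -
  have "\<bar>small_rep u - small_rep v\<bar> < 1/2"
    using assms abs_small_rep[of u] abs_small_rep[of v] by linarith
  then have "round (small_rep u - small_rep v) = 0"
    by (intro round_unique') simp
  then show ?thesis
    using dist_abs_circle[of "small_rep u" "small_rep v"] by simp
qed

lemma continuous_on_small_rep: "continuous_on {u. dist u 0 < 1/4} small_rep"
  unfolding continuous_on_iff
  by (auto simp: dist_real_def abs_small_rep_diff)

lemma dist_fun_translate:
  fixes x y :: "'g::countable \<Rightarrow> circle"
  shows "dist (x + z) (y + z) = dist x y"
  by (simp add: dist_fun_def dist_circle_eq[of "_ + _"] dist_circle_eq[of "x _"])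

lemma bounded_act:
  assumes "\<And>\<gamma>. \<bar>v \<gamma>\<bar> \<le> M"
  shows "\<bar>(g \<star> v) \<gamma>\<bar> \<le> (\<Sum>\<eta>\<in>Poly_Mapping.keys g. \<bar>of_int (Poly_Mapping.lookup g \<eta>)\<bar>) * M"
  unfolding act_def sum_distrib_right real_scale_def
  by (rule sum_abs[THEN order_trans], rule sum_mono) (simp add: abs_mult assms mult_left_mono)

lemma proj_eq_0_iff: "proj v = 0 \<longleftrightarrow> (\<forall>\<gamma>. v \<gamma> \<in> \<int>)"
  by (auto simp: proj_def fun_eq_iff abs_circle_eq_0_iff)

section \<open>Extending characters\<close>

text \<open>Divisibility of the circle is what makes characters extend.\<close>

lemma circle_divisible:
  assumes "n \<noteq> 0"
  obtains t where "int_scale n t = u"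
proof
  have "int_scale n (abs_circle (small_rep u / of_int n)) = abs_circle (small_rep u)"
    using assms by (simp flip: abs_circle_real_scale add: real_scale_def)
  then show "int_scale n (abs_circle (small_rep u / of_int n)) = u" by simp
qed

text \<open>A partial character is represented by its graph, a subgroup of the product which contains no
  \<open>(0, t)\<close> with \<open>t \<noteq> 0\<close>. A multiple of \<open>a\<close> that already lies in the domain prescribes the value of a
  multiple of \<open>t\<close>; all these conditions follow from the one at the least positive such multiple,
  and that one is solved by divisibility.\<close>

lemma subgroup_graph_extend:
  fixes M :: "('a::ab_group_add \<times> circle) set" and scale :: "int \<Rightarrow> 'a \<Rightarrow> 'a"
  assumes "module scale"
    and diff: "\<And>p q. p \<in> M \<Longrightarrow> q \<in> M \<Longrightarrow> p - q \<in> M"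
    and univalent: "\<And>t. (0, t) \<in> M \<Longrightarrow> t = 0"
    and nonempty: "M \<noteq> {}"
  obtains M' t where "M \<subseteq> M'" "(a, t) \<in> M'"
    "\<And>p q. p \<in> M' \<Longrightarrow> q \<in> M' \<Longrightarrow> p - q \<in> M'" "\<And>t. (0, t) \<in> M' \<Longrightarrow> t = 0"
proof -
  interpret module scale by fact
  have zero: "(0, 0) \<in> M" using nonempty diff by (metis all_not_in_conv diff_self zero_prod_def)
  have uminus: "- p \<in> M" if "p \<in> M" for p
    using diff[OF zero that] by (simp add: zero_prod_def[symmetric])
  have add: "p + q \<in> M" if "p \<in> M" "q \<in> M" for p q
    using diff[OF that(1) uminus[OF that(2)]] by simp
  have mult: "(scale n b, int_scale n v) \<in> M" if "(b, v) \<in> M" for n b v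
  proof (induction n rule: int_induct[where k = 0])
    case base
    then show ?case using zero by simp
  next
    case (step1 i)
    then show ?case using add[OF step1(2) that] by (simp add: scale_left_distrib int_scale_add)
  next
    case (step2 i)
    then show ?case using diff[OF step2(2) that]
      by (simp add: scale_left_diff_distrib circle.scale_left_diff_distrib)
  qed
  obtain t where t: "\<And>n v. (scale n a, v) \<in> M \<Longrightarrow> v = int_scale n t"
  \<comment> \<open>If no positive multiple of \<open>a\<close> is in the domain, any value does, for instance \<open>0\<close>.\<close>
  proof (cases "\<exists>n>0. \<exists>v. (scale (int n) a, v) \<in> M")
    case False
    have "v = int_scale n 0" if "(scale n a, v) \<in> M" for n v
    proof -
      have "\<not> 0 < n"
        using False that by (metis zero_less_imp_eq_int)
      moreover have "\<not> n < 0"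
      proof
        assume n: "n < 0"
        from uminus[OF that] have "(scale (- n) a, - v) \<in> M" by simp
        then show False using n False by (metis neg_0_less_iff_less zero_less_imp_eq_int)
      qed
      ultimately have "n = 0" by simp
      then show ?thesis using that univalent by simp
    qed
    then show ?thesis using that by blast
  next
    case True
    define m where "m = (LEAST n. 0 < n \<and> (\<exists>v. (scale (int n) a, v) \<in> M))"
    obtain v0 where m: "0 < m" and v0: "(scale (int m) a, v0) \<in> M"
      using LeastI_ex[OF True] unfolding m_def by blast
    have least: "\<not> (0 < n \<and> n < m)" if "(scale (int n) a, v) \<in> M" for n v
      using that not_less_Least unfolding m_def by blast
    obtain t where t: "int_scale (int m) t = v0"
      using circle_divisible[of "int m"] m by auto
    have "v = int_scale n t" if "(scale n a, v) \<in> M" for n v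
    proof -
      let ?q = "n div int m" and ?r = "n mod int m"
      have n: "n = ?q * int m + ?r" by simp
      have "(scale n a - scale ?q (scale (int m) a), v - int_scale ?q v0) \<in> M"
        using diff[OF that mult[OF v0, of ?q]] by simp
      moreover have "scale n a - scale ?q (scale (int m) a) = scale ?r a"
        by (subst n) (simp only: scale_left_distrib scale_scale add_diff_cancel_left')
      ultimately have r: "(scale ?r a, v - int_scale ?q v0) \<in> M" by simp
      have "?r = 0"
      proof (rule ccontr)
        assume "?r \<noteq> 0"
        moreover have "0 \<le> ?r" "?r < int m" using m by simp_all
        ultimately have "0 < nat ?r \<and> nat ?r < m" by linarith
        moreover have "(scale (int (nat ?r)) a, v - int_scale ?q v0) \<in> M" using r \<open>0 \<le> ?r\<close> by simp
        ultimately show False using least by blast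
      qed
      then have "v - int_scale ?q v0 = 0" using univalent[of "v - int_scale ?q v0"] r by simp
      moreover have "int_scale ?q v0 = int_scale n t"
        using n \<open>?r = 0\<close> by (metis add.right_neutral int_scale_mult t)
      ultimately show ?thesis by simp
    qed
    then show ?thesis using that by blast
  qed
  define M' where "M' = {(b + scale n a, u + int_scale n t) | b u n. (b, u) \<in> M}"
  show thesis
  proof
    have "(b, u) \<in> M'" if "(b, u) \<in> M" for b u
      unfolding M'_def using that by (intro CollectI exI[of _ b] exI[of _ u] exI[of _ 0]) simp
    then show "M \<subseteq> M'" by auto
    show "(a, t) \<in> M'"
      unfolding M'_def using zero by (intro CollectI exI[of _ 0] exI[of _ 0] exI[of _ 1]) simp
    show "p - q \<in> M'" if pq: "p \<in> M'" "q \<in> M'" for p q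
    proof -
      obtain b u n where "p = (b + scale n a, u + int_scale n t)" "(b, u) \<in> M"
        using pq(1) unfolding M'_def by auto
      moreover obtain c v k where "q = (c + scale k a, v + int_scale k t)" "(c, v) \<in> M"
        using pq(2) unfolding M'_def by auto
      ultimately show ?thesis using diff[of "(b, u)" "(c, v)"]
        unfolding M'_def
        by (intro CollectI exI[of _ "b - c"] exI[of _ "u - v"] exI[of _ "n - k"])
          (simp add: scale_left_diff_distrib circle.scale_left_diff_distrib)
    qed
    show "w = 0" if zero_w: "(0, w) \<in> M'" for w
    proof -
      obtain b u n where b: "b + scale n a = 0" and w: "w = u + int_scale n t" and bu: "(b, u) \<in> M"
        using zero_w unfolding M'_def by (smt (verit) mem_Collect_eq prod.inject)
      have "- b = scale n a" using b by (rule minus_unique)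
      then have "(scale n a, - u) \<in> M" using uminus[OF bu] by simp
      then have "- u = int_scale n t" by (rule t)
      then show ?thesis using w by (metis add.right_inverse)
    qed
  qed
qed

text \<open>Zorn's lemma on graphs: by \<open>subgroup_graph_extend\<close> a maximal graph has full domain.\<close>

lemma extend_circle_character:
  fixes \<psi> :: "'a::ab_group_add \<Rightarrow> circle" and scale :: "int \<Rightarrow> 'a \<Rightarrow> 'a"
  assumes "module scale"
    and H: "H \<noteq> {}" "\<And>a b. a \<in> H \<Longrightarrow> b \<in> H \<Longrightarrow> a - b \<in> H"
    and \<psi>: "\<And>a b. a \<in> H \<Longrightarrow> b \<in> H \<Longrightarrow> \<psi> (a - b) = \<psi> a - \<psi> b"
  obtains \<Psi> where "\<And>a b. \<Psi> (a + b) = \<Psi> a + \<Psi> b" "\<And>a. a \<in> H \<Longrightarrow> \<Psi> a = \<psi> a"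
proof -
  define S where "S = (\<lambda>a. (a, \<psi> a)) ` H"
  define \<G> where "\<G> = {M. S \<subseteq> M \<and> (\<forall>p\<in>M. \<forall>q\<in>M. p - q \<in> M) \<and> (\<forall>t. (0, t) \<in> M \<longrightarrow> t = 0)}"
  have "S \<in> \<G>"
    unfolding \<G>_def S_def using H \<psi> by (auto simp: image_iff) (metis diff_self)
  moreover have "\<Union>\<C> \<in> \<G>" if "\<C> \<noteq> {}" and "subset.chain \<G> \<C>" for \<C>
  proof -
    have sub: "\<C> \<subseteq> \<G>" and lin: "\<And>A B. A \<in> \<C> \<Longrightarrow> B \<in> \<C> \<Longrightarrow> A \<subseteq> B \<or> B \<subseteq> A"
      using that(2) by (auto simp: subset.chain_def)
    have "p - q \<in> \<Union>\<C>" if pq: "p \<in> \<Union>\<C>" "q \<in> \<Union>\<C>" for p q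
    proof -
      obtain A B where "A \<in> \<C>" "p \<in> A" "B \<in> \<C>" "q \<in> B"
        using pq by blast
      then obtain A where "A \<in> \<C>" "p \<in> A" "q \<in> A"
        using lin[of A B] by blast
      moreover have "A \<in> \<G>" using sub \<open>A \<in> \<C>\<close> by blast
      ultimately have "p - q \<in> A" unfolding \<G>_def by blast
      then show ?thesis using \<open>A \<in> \<C>\<close> by blast
    qed
    moreover have "t = 0" if "(0, t) \<in> \<Union>\<C>" for t
    proof -
      obtain A where "(0, t) \<in> A" "A \<in> \<C>" using \<open>(0, t) \<in> \<Union>\<C>\<close> by (rule UnionE)
      moreover have "A \<in> \<G>" using sub \<open>A \<in> \<C>\<close> by (rule subsetD)
      ultimately show ?thesis by (simp add: \<G>_def)
    qed
    moreover have "S \<subseteq> \<Union>\<C>"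
    proof -
      obtain A where "A \<in> \<C>" using \<open>\<C> \<noteq> {}\<close> by blast
      moreover have "A \<in> \<G>" using sub \<open>A \<in> \<C>\<close> by (rule subsetD)
      then have "S \<subseteq> A" by (simp add: \<G>_def)
      ultimately show ?thesis by blast
    qed
    ultimately show ?thesis unfolding \<G>_def by (intro CollectI conjI ballI allI impI)
  qed
  ultimately have "\<exists>M\<in>\<G>. \<forall>X\<in>\<G>. M \<subseteq> X \<longrightarrow> X = M"
    by (intro subset_Zorn_nonempty) auto
  then obtain M where M: "M \<in> \<G>" and max: "\<And>X. X \<in> \<G> \<Longrightarrow> M \<subseteq> X \<Longrightarrow> X = M"
    by blast
  have diff: "p - q \<in> M" if "p \<in> M" "q \<in> M" for p q using M that by (auto simp: \<G>_def)
  have univalent: "t = 0" if "(0, t) \<in> M" for t using M that by (auto simp: \<G>_def)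
  have "S \<subseteq> M" using M by (auto simp: \<G>_def)
  then have "M \<noteq> {}" using H(1) by (auto simp: S_def)
  have "\<exists>u. (a, u) \<in> M" for a
  proof -
    obtain M' t where M': "M \<subseteq> M'" "(a, t) \<in> M'"
      "\<And>p q. p \<in> M' \<Longrightarrow> q \<in> M' \<Longrightarrow> p - q \<in> M'" "\<And>t. (0, t) \<in> M' \<Longrightarrow> t = 0"
      using subgroup_graph_extend[OF assms(1) diff univalent \<open>M \<noteq> {}\<close>] by blast
    then have "M' \<in> \<G>" using \<open>S \<subseteq> M\<close> by (auto simp: \<G>_def)
    then show ?thesis using max M' by blast
  qed
  then obtain \<Psi> where \<Psi>: "\<And>a. (a, \<Psi> a) \<in> M" by metis
  have unique: "u = \<Psi> a" if "(a, u) \<in> M" for a u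
    using diff[OF that \<Psi>[of a]] univalent[of "u - \<Psi> a"] by simp
  show thesis
  proof
    fix a b
    have "((a + b) - b, \<Psi> (a + b) - \<Psi> b) \<in> M" using diff[OF \<Psi>[of "a + b"] \<Psi>[of b]] by simp
    then have "\<Psi> (a + b) - \<Psi> b = \<Psi> a" using unique by simp
    then show "\<Psi> (a + b) = \<Psi> a + \<Psi> b" by (simp add: algebra_simps)
  next
    fix a assume "a \<in> H"
    then show "\<Psi> a = \<psi> a" using \<open>S \<subseteq> M\<close> unique[of a "\<psi> a"] by (auto simp: S_def)
  qed
qed

section \<open>Configurations vanishing at infinity\<close>

text \<open>Tending to \<open>0\<close> at infinity; by \<open>homoclinic_iff_vanishing\<close> below, this describes the points homoclinic to \<open>0\<close>.\<close>

definition vanishing :: "('g \<Rightarrow> 'a::{metric_space, zero}) \<Rightarrow> bool"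
  where "vanishing x \<longleftrightarrow> (\<forall>\<epsilon>>0. finite {\<gamma>. \<epsilon> \<le> dist (x \<gamma>) 0})"

lemma vanishing_real_act:
  fixes g :: "'g::ab_group_add \<Rightarrow>\<^sub>0 int"
  assumes "vanishing v"
  shows "vanishing (g \<star> v)"
  unfolding vanishing_def
proof (intro allI impI)
  fix \<epsilon> :: real assume "0 < \<epsilon>"
  define S where "S = (\<Sum>\<eta>\<in>Poly_Mapping.keys g. \<bar>of_int (Poly_Mapping.lookup g \<eta>) :: real\<bar>)"
  have S: "0 \<le> S" by (simp add: S_def sum_nonneg)
  define \<delta> where "\<delta> = \<epsilon> / (S + 1)"
  have "\<delta> > 0" using \<open>0 < \<epsilon>\<close> S by (simp add: \<delta>_def)
  define B where "B = {\<gamma>. \<delta> \<le> \<bar>v \<gamma>\<bar>}"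
  have "finite B" using assms \<open>\<delta> > 0\<close> by (simp add: vanishing_def B_def)
  have "{\<gamma>. \<epsilon> \<le> dist ((g \<star> v) \<gamma>) 0} \<subseteq> (\<Union>\<eta>\<in>Poly_Mapping.keys g. (\<lambda>\<beta>. \<beta> - \<eta>) ` B)"
  proof (rule subsetI, rule ccontr)
    fix \<gamma> assume big: "\<gamma> \<in> {\<gamma>. \<epsilon> \<le> dist ((g \<star> v) \<gamma>) 0}"
      and out: "\<gamma> \<notin> (\<Union>\<eta>\<in>Poly_Mapping.keys g. (\<lambda>\<beta>. \<beta> - \<eta>) ` B)"
    have small: "\<bar>v (\<gamma> + \<eta>)\<bar> \<le> \<delta>" if "\<eta> \<in> Poly_Mapping.keys g" for \<eta>
    proof -
      have "\<gamma> + \<eta> \<notin> B" using out that by force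
      then show ?thesis by (simp add: B_def)
    qed
    have "\<bar>(g \<star> v) \<gamma>\<bar> \<le> (\<Sum>\<eta>\<in>Poly_Mapping.keys g. \<bar>of_int (Poly_Mapping.lookup g \<eta>)\<bar> * \<delta>)"
      unfolding act_def real_scale_def
      by (rule sum_abs[THEN order_trans], rule sum_mono) (simp add: abs_mult small mult_left_mono)
    also have "\<dots> = S * \<delta>" by (simp add: S_def sum_distrib_right)
    also have "\<dots> < \<epsilon>" using S \<open>0 < \<epsilon>\<close> by (simp add: \<delta>_def field_simps)
    finally show False using big by simp
  qed
  then show "finite {\<gamma>. \<epsilon> \<le> dist ((g \<star> v) \<gamma>) 0}"
    by (rule finite_subset) (simp add: \<open>finite B\<close>)
qed

lemma vanishing_proj:
  assumes "vanishing v"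
  shows "vanishing (proj v)"
  unfolding vanishing_def
proof (intro allI impI)
  fix \<epsilon> :: real assume "0 < \<epsilon>"
  then have "finite {\<gamma>. \<epsilon> \<le> dist (v \<gamma>) 0}" using assms by (simp add: vanishing_def)
  moreover have "dist (proj v \<gamma>) 0 \<le> dist (v \<gamma>) 0" for \<gamma>
    using dist_abs_circle_le[of "v \<gamma>" 0] by (simp add: proj_def)
  ultimately show "finite {\<gamma>. \<epsilon> \<le> dist (proj v \<gamma>) 0}"
    by (elim finite_subset[rotated]) (auto intro: order_trans)
qed

lemma vanishing_diff:
  fixes x y :: "'g \<Rightarrow> circle"
  assumes "vanishing x" "vanishing y"
  shows "vanishing (x - y)"
  unfolding vanishing_def
proof (intro allI impI)
  fix \<epsilon> :: real assume "0 < \<epsilon>"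
  have "dist ((x - y) \<gamma>) 0 \<le> dist (x \<gamma>) 0 + dist (y \<gamma>) 0" for \<gamma>
    using dist_triangle2[of "x \<gamma>" "y \<gamma>" 0] by (simp add: dist_circle_eq[of "x \<gamma>" "y \<gamma>"])
  then have "{\<gamma>. \<epsilon> \<le> dist ((x - y) \<gamma>) 0} \<subseteq> {\<gamma>. \<epsilon> / 2 \<le> dist (x \<gamma>) 0} \<union> {\<gamma>. \<epsilon> / 2 \<le> dist (y \<gamma>) 0}"
    by (smt (verit) Collect_mono_iff Un_def field_sum_of_halves mem_Collect_eq)
  moreover have "finite ({\<gamma>. \<epsilon> / 2 \<le> dist (x \<gamma>) 0} \<union> {\<gamma>. \<epsilon> / 2 \<le> dist (y \<gamma>) 0})"
    using assms \<open>0 < \<epsilon>\<close> half_gt_zero[of \<epsilon>] unfolding vanishing_def by blast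
  ultimately show "finite {\<gamma>. \<epsilon> \<le> dist ((x - y) \<gamma>) 0}" by (rule finite_subset)
qed

section \<open>Solving linear equations over bounded real configurations\<close>

lemma compact_box: "compact {v :: 'g \<Rightarrow> real. \<forall>\<gamma>. \<bar>v \<gamma>\<bar> \<le> M}"
proof -
  have "compactin (product_topology (\<lambda>_ :: 'g. euclidean) UNIV) (\<Pi>\<^sub>E \<gamma>\<in>UNIV. {-M..M})"
    unfolding compactin_PiE by simp
  moreover have "(\<Pi>\<^sub>E \<gamma>\<in>UNIV. {-M..M}) = {v :: 'g \<Rightarrow> real. \<forall>\<gamma>. \<bar>v \<gamma>\<bar> \<le> M}"
    by (auto simp: PiE_def Pi_def abs_le_iff minus_le_iff)
  ultimately show ?thesis by (simp add: euclidean_product_topology)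
qed

lemma continuous_on_real_act: "continuous_on A (\<lambda>v. (g \<star> v) \<gamma>)"
  unfolding act_def real_scale_def
  by (intro continuous_intros continuous_on_subset[OF continuous_on_product_coordinates]) simp_all

lemma poly_mapping_of_finite:
  assumes "finite {\<gamma>. a \<gamma> \<noteq> 0}"
  obtains h where "Poly_Mapping.lookup h = a"
  using assms by (metis lookup_Abs_poly_mapping)

text \<open>The identity of the group ring as a real configuration.\<close>

abbreviation delta :: "'g::ab_group_add \<Rightarrow> real" where "delta \<equiv> (\<lambda>\<gamma>. if \<gamma> = 0 then 1 else 0)"

text \<open>The form in which expansiveness enters the argument.\<close>

locale bounded_injective =
  fixes f :: "'g::ab_group_add \<Rightarrow>\<^sub>0 int"
  assumes bounded_kernel: "\<lbrakk>\<And>\<gamma>. \<bar>v \<gamma>\<bar> \<le> M; f \<star> v = 0\<rbrakk> \<Longrightarrow> v = 0"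
begin

text \<open>The configurations bounded by \<open>M\<close> whose value at \<open>0\<close> is at least \<open>\<epsilon>\<close> in absolute value form a
  compact set on which \<open>f \<star> v\<close> never vanishes identically; a finite subcover shows that finitely
  many coordinates of \<open>f \<star> v\<close> detect this uniformly.\<close>

lemma local_control:
  assumes "\<epsilon> > 0"
  obtains E c where "finite E" "c > 0"
    "\<And>v. (\<And>\<gamma>. \<bar>v \<gamma>\<bar> \<le> M) \<Longrightarrow> (\<And>\<gamma>. \<gamma> \<in> E \<Longrightarrow> \<bar>(f \<star> v) \<gamma>\<bar> < c) \<Longrightarrow> \<bar>v 0\<bar> < \<epsilon>"
proof -
  define K where "K = {v :: 'g \<Rightarrow> real. \<forall>\<gamma>. \<bar>v \<gamma>\<bar> \<le> M} \<inter> {v. \<epsilon> \<le> \<bar>v 0\<bar>}"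
  have "closed {v :: 'g \<Rightarrow> real. \<epsilon> \<le> \<bar>v 0\<bar>}"
    by (intro closed_Collect_le continuous_intros continuous_on_product_coordinates)
  then have K: "compact K"
    unfolding K_def by (rule compact_Int_closed[OF compact_box])
  define U where "U p = {v. inverse (of_nat (Suc (snd p))) < \<bar>(f \<star> v) (fst p)\<bar>}" for p
  have U: "open (U p)" for p
    unfolding U_def by (intro open_Collect_less continuous_intros continuous_on_real_act)
  have cover: "K \<subseteq> (\<Union>p\<in>UNIV. U p)"
  proof
    fix v assume v: "v \<in> K"
    have "f \<star> v \<noteq> 0"
    proof
      assume "f \<star> v = 0"
      then have "v = 0" using v bounded_kernel[of v M] by (simp add: K_def)
      then show False using v \<open>\<epsilon> > 0\<close> by (simp add: K_def)
    qed
    then obtain \<gamma> where "(f \<star> v) \<gamma> \<noteq> 0" by (auto simp: fun_eq_iff)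
    then obtain n where "inverse (real (Suc n)) < \<bar>(f \<star> v) \<gamma>\<bar>"
      using reals_Archimedean[of "\<bar>(f \<star> v) \<gamma>\<bar>"] by auto
    then have "v \<in> U (\<gamma>, n)" by (simp add: U_def)
    then show "v \<in> (\<Union>p\<in>UNIV. U p)" by blast
  qed
  obtain P where P: "P \<subseteq> UNIV" "finite P" "K \<subseteq> (\<Union>p\<in>P. U p)"
    by (rule compactE_image[OF K U cover])
  define c where "c = inverse (real (Suc (\<Sum>p\<in>P. snd p)))"
  show thesis
  proof
    show "finite (fst ` P)" "c > 0" using P by (simp_all add: c_def del: of_nat_Suc)
    fix v :: "'g \<Rightarrow> real"
    assume v: "\<And>\<gamma>. \<bar>v \<gamma>\<bar> \<le> M" and small: "\<And>\<gamma>. \<gamma> \<in> fst ` P \<Longrightarrow> \<bar>(f \<star> v) \<gamma>\<bar> < c"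
    show "\<bar>v 0\<bar> < \<epsilon>"
    proof (rule ccontr)
      assume "\<not> \<bar>v 0\<bar> < \<epsilon>"
      then have "v \<in> K" using v by (simp add: K_def)
      then obtain p where p: "p \<in> P" "v \<in> U p" using P by blast
      have "snd p \<le> (\<Sum>p\<in>P. snd p)" using P p by (intro member_le_sum) auto
      then have "c \<le> inverse (real (Suc (snd p)))"
        unfolding c_def by (intro le_imp_inverse_le) (simp_all del: of_nat_Suc)
      also have "\<dots> < \<bar>(f \<star> v) (fst p)\<bar>" using p by (simp add: U_def)
      finally show False using small[of "fst p"] p by simp
    qed
  qed
qed

lemma local_control_at:
  assumes "\<epsilon> > 0"
  obtains E c where "finite E" "c > 0"
    "\<And>v \<beta>. (\<And>\<gamma>. \<bar>v \<gamma>\<bar> \<le> M) \<Longrightarrow> (\<And>\<gamma>. \<gamma> \<in> E \<Longrightarrow> \<bar>(f \<star> v) (\<beta> + \<gamma>)\<bar> < c) \<Longrightarrow> \<bar>v \<beta>\<bar> < \<epsilon>"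
proof -
  obtain E c where Ec: "finite E" "c > 0" and
    ctl: "\<And>v. (\<And>\<gamma>. \<bar>v \<gamma>\<bar> \<le> M) \<Longrightarrow> (\<And>\<gamma>. \<gamma> \<in> E \<Longrightarrow> \<bar>(f \<star> v) \<gamma>\<bar> < c) \<Longrightarrow> \<bar>v 0\<bar> < \<epsilon>"
    using local_control[OF assms, where M = M] by blast
  have "\<bar>v \<beta>\<bar> < \<epsilon>"
    if "\<And>\<gamma>. \<bar>v \<gamma>\<bar> \<le> M" "\<And>\<gamma>. \<gamma> \<in> E \<Longrightarrow> \<bar>(f \<star> v) (\<beta> + \<gamma>)\<bar> < c" for v \<beta>
    using ctl[of "shift (- \<beta>) v"] that by (simp add: act_shift) (simp add: shift_def)
  with Ec that show thesis by blast
qed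

text \<open>After rescaling \<open>v\<close> to supremum 1, the local estimate for the value \<open>1/2\<close> at a point where the
  supremum is nearly attained bounds \<open>f \<star> v\<close> from below.\<close>

lemma bounded_below:
  obtains C where "C > 0"
    "\<And>v M B \<beta>. (\<And>\<gamma>. \<bar>v \<gamma>\<bar> \<le> M) \<Longrightarrow> (\<And>\<gamma>. \<bar>(f \<star> v) \<gamma>\<bar> \<le> B) \<Longrightarrow> \<bar>v \<beta>\<bar> \<le> C * B"
proof -
  obtain E c where Ec: "finite E" "c > 0" and
    ctl: "\<And>v \<beta>. (\<And>\<gamma>. \<bar>v \<gamma>\<bar> \<le> 1) \<Longrightarrow> (\<And>\<gamma>. \<gamma> \<in> E \<Longrightarrow> \<bar>(f \<star> v) (\<beta> + \<gamma>)\<bar> < c) \<Longrightarrow> \<bar>v \<beta>\<bar> < 1/2"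
    by (rule local_control_at[of "1/2" 1]) auto
  show thesis
  proof
    show "inverse c > 0" using \<open>c > 0\<close> by simp
    fix v :: "'g \<Rightarrow> real" and M B :: real and \<beta>
    assume v: "\<And>\<gamma>. \<bar>v \<gamma>\<bar> \<le> M" and B: "\<And>\<gamma>. \<bar>(f \<star> v) \<gamma>\<bar> \<le> B"
    define s where "s = (SUP \<gamma>. \<bar>v \<gamma>\<bar>)"
    have bdd: "bdd_above (range (\<lambda>\<gamma>. \<bar>v \<gamma>\<bar>))" using v by (auto simp: bdd_above_def)
    have le_s: "\<bar>v \<gamma>\<bar> \<le> s" for \<gamma> unfolding s_def by (rule cSUP_upper[OF _ bdd]) simp
    have "B \<ge> 0" using B[of 0] by linarith
    have "s \<le> inverse c * B"
    proof (rule ccontr)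
      assume "\<not> s \<le> inverse c * B"
      then have gt: "B < c * s" using \<open>c > 0\<close> by (simp add: field_simps)
      then have "0 < c * s" using \<open>B \<ge> 0\<close> by linarith
      then have "s > 0" using \<open>c > 0\<close> by (simp add: zero_less_mult_iff)
      define u where "u = (\<lambda>\<gamma>. v \<gamma> / s)"
      have fu: "(f \<star> u) \<gamma> = (f \<star> v) \<gamma> / s" for \<gamma>
        by (simp add: act_def u_def real_scale_def sum_divide_distrib)
      have "\<bar>u \<gamma>\<bar> < 1/2" for \<gamma>
      proof (rule ctl)
        show "\<bar>u \<gamma>\<bar> \<le> 1" for \<gamma> using le_s[of \<gamma>] \<open>s > 0\<close> by (simp add: u_def)
        have "\<bar>(f \<star> u) \<gamma>\<bar> < c" for \<gamma>
          using B[of \<gamma>] gt \<open>s > 0\<close> by (simp add: fu field_simps)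
        then show "\<bar>(f \<star> u) (\<gamma> + \<gamma>')\<bar> < c" for \<gamma>' .
      qed
      then have "\<bar>v \<gamma>\<bar> \<le> s / 2" for \<gamma> using \<open>s > 0\<close> by (simp add: u_def field_simps less_imp_le)
      then have "s \<le> s / 2" unfolding s_def[symmetric] by (subst s_def) (rule cSUP_least, auto)
      then show False using \<open>s > 0\<close> by simp
    qed
    then show "\<bar>v \<beta>\<bar> \<le> inverse c * B" using le_s[of \<beta>] by linarith
  qed
qed

end

text \<open>The sign comes from \<open>(g \<star> v) \<gamma>\<close> reading \<open>v\<close> at \<open>\<gamma> + \<eta>\<close>: acting on \<open>delta\<close> reflects \<open>g\<close>.\<close>

lemma act_delta: "(g \<star> delta) \<gamma> = of_int (Poly_Mapping.lookup g (- \<gamma>))"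
proof -
  have "(g \<star> delta) \<gamma> = (\<Sum>\<eta>\<in>Poly_Mapping.keys g. if \<eta> = - \<gamma> then of_int (Poly_Mapping.lookup g \<eta>) else 0)"
    unfolding act_def real_scale_def by (intro sum.cong) (auto simp: add_eq_0_iff)
  also have "\<dots> = of_int (Poly_Mapping.lookup g (- \<gamma>))"
    by (simp add: in_keys_iff)
  finally show ?thesis .
qed

lemma integer_valued_eq_act_delta:
  fixes v :: "'g::ab_group_add \<Rightarrow> real"
  assumes "\<And>\<gamma>. v \<gamma> \<in> \<int>" "finite {\<gamma>. v \<gamma> \<noteq> 0}"
  obtains g where "g \<star> delta = v"
proof -
  define a where "a = (\<lambda>\<gamma>. \<lfloor>v (- \<gamma>)\<rfloor>)"
  have v: "of_int (a (- \<gamma>)) = v \<gamma>" for \<gamma>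
    using assms(1)[of \<gamma>] by (simp add: a_def)
  have "{\<gamma>. a \<gamma> \<noteq> 0} \<subseteq> uminus ` {\<gamma>. v \<gamma> \<noteq> 0}"
  proof
    fix \<gamma> assume "\<gamma> \<in> {\<gamma>. a \<gamma> \<noteq> 0}"
    then have "- \<gamma> \<in> {\<gamma>. v \<gamma> \<noteq> 0}" by (auto simp: a_def)
    then show "\<gamma> \<in> uminus ` {\<gamma>. v \<gamma> \<noteq> 0}" by (metis image_eqI minus_minus)
  qed
  then have "finite {\<gamma>. a \<gamma> \<noteq> 0}" using assms(2) finite_surj by blast
  then obtain g where g: "Poly_Mapping.lookup g = a" by (rule poly_mapping_of_finite)
  have "g \<star> delta = v" by (rule ext) (simp add: act_delta g v)
  then show thesis by (rule that)
qed

lemma vanishing_integer_valued_finite: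
  fixes v :: "'g \<Rightarrow> real"
  assumes "vanishing v" "\<And>\<gamma>. v \<gamma> \<in> \<int>"
  shows "finite {\<gamma>. v \<gamma> \<noteq> 0}"
proof -
  have "{\<gamma>. v \<gamma> \<noteq> 0} \<subseteq> {\<gamma>. 1 \<le> dist (v \<gamma>) 0}"
    using assms(2) Ints_nonzero_abs_ge1 by auto
  moreover have "finite {\<gamma>. 1 \<le> dist (v \<gamma>) 0}"
    using assms(1) unfolding vanishing_def by (metis zero_less_one)
  ultimately show ?thesis by (rule finite_subset)
qed

text \<open>The adjoint of \<open>f\<close> is \<open>f\<close> itself conjugated by the reflection \<open>\<gamma> \<mapsto> - \<gamma>\<close>, so that lower bounds for \<open>f\<close>
  hold for its adjoint too.\<close>

lemma sum_act_adjoint: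
  fixes f :: "'g::ab_group_add \<Rightarrow>\<^sub>0 int"
  assumes "finite F" "\<And>\<gamma>. \<gamma> \<notin> F \<Longrightarrow> u \<gamma> = 0"
  defines "S \<equiv> (\<lambda>(\<gamma>, \<eta>). \<gamma> + \<eta>) ` (F \<times> Poly_Mapping.keys f)"
  shows "(\<Sum>\<gamma>\<in>F. u \<gamma> * (f \<star> w) \<gamma>) = (\<Sum>\<zeta>\<in>S. (f \<star> (\<lambda>\<gamma>. u (- \<gamma>))) (- \<zeta>) * w \<zeta>)"
    and "\<zeta> \<notin> S \<Longrightarrow> (f \<star> (\<lambda>\<gamma>. u (- \<gamma>))) (- \<zeta>) = 0"
proof -
  let ?k = "Poly_Mapping.keys f" and ?f = "\<lambda>\<eta>. real_of_int (Poly_Mapping.lookup f \<eta>)"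
  have finS: "finite S" using assms(1) by (simp add: S_def)
  have "(\<Sum>\<gamma>\<in>F. u \<gamma> * (?f \<eta> * w (\<gamma> + \<eta>))) = (\<Sum>\<zeta>\<in>S. ?f \<eta> * u (\<zeta> - \<eta>) * w \<zeta>)" if \<eta>: "\<eta> \<in> ?k" for \<eta>
  proof -
    have "(\<Sum>\<gamma>\<in>F. u \<gamma> * (?f \<eta> * w (\<gamma> + \<eta>))) =
        (\<Sum>\<zeta>\<in>(\<lambda>\<gamma>. \<gamma> + \<eta>) ` F. ?f \<eta> * u (\<zeta> - \<eta>) * w \<zeta>)"
      by (subst sum.reindex) (simp_all add: inj_on_def mult_ac)
    also have "\<dots> = (\<Sum>\<zeta>\<in>S. ?f \<eta> * u (\<zeta> - \<eta>) * w \<zeta>)"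
    proof (rule sum.mono_neutral_left[OF finS])
      show "(\<lambda>\<gamma>. \<gamma> + \<eta>) ` F \<subseteq> S" using \<eta> by (auto simp: S_def)
      have "u (\<zeta> - \<eta>) = 0" if "\<zeta> \<notin> (\<lambda>\<gamma>. \<gamma> + \<eta>) ` F" for \<zeta>
        using that by (intro assms(2)) (metis diff_add_cancel image_eqI)
      then show "\<forall>\<zeta>\<in>S - (\<lambda>\<gamma>. \<gamma> + \<eta>) ` F. ?f \<eta> * u (\<zeta> - \<eta>) * w \<zeta> = 0" by simp
    qed
    finally show ?thesis .
  qed
  then have "(\<Sum>\<eta>\<in>?k. \<Sum>\<gamma>\<in>F. u \<gamma> * (?f \<eta> * w (\<gamma> + \<eta>))) = (\<Sum>\<eta>\<in>?k. \<Sum>\<zeta>\<in>S. ?f \<eta> * u (\<zeta> - \<eta>) * w \<zeta>)"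
    by (rule sum.cong[OF refl])
  then show "(\<Sum>\<gamma>\<in>F. u \<gamma> * (f \<star> w) \<gamma>) = (\<Sum>\<zeta>\<in>S. (f \<star> (\<lambda>\<gamma>. u (- \<gamma>))) (- \<zeta>) * w \<zeta>)"
    by (simp add: act_def real_scale_def sum_distrib_left sum_distrib_right sum.swap[of _ ?k])
  show "(f \<star> (\<lambda>\<gamma>. u (- \<gamma>))) (- \<zeta>) = 0" if "\<zeta> \<notin> S"
  proof -
    have "u (\<zeta> - \<eta>) = 0" if "\<eta> \<in> ?k" for \<eta>
    proof (rule assms(2))
      show "\<zeta> - \<eta> \<notin> F"
      proof
        assume "\<zeta> - \<eta> \<in> F"
        then have "(\<lambda>(\<gamma>, \<eta>). \<gamma> + \<eta>) (\<zeta> - \<eta>, \<eta>) \<in> S" unfolding S_def using that by blast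
        then show False using \<open>\<zeta> \<notin> S\<close> by simp
      qed
    qed
    then show ?thesis by (simp add: act_def real_scale_def)
  qed
qed

text \<open>For small \<open>t\<close> the linear term dominates the quadratic one.\<close>

lemma first_variation_nonpos:
  fixes a b :: real
  assumes "\<And>t. 0 < t \<Longrightarrow> t \<le> 1 \<Longrightarrow> 2 * t * a \<le> t\<^sup>2 * b" "0 \<le> b"
  shows "a \<le> 0"
proof (rule ccontr)
  assume a: "\<not> a \<le> 0"
  define t where "t = min 1 (a / (b + 1))"
  have t: "0 < t" "t \<le> 1" using a assms(2) by (auto simp: t_def)
  have "t * b \<le> a / (b + 1) * b" using assms(2) by (intro mult_right_mono) (auto simp: t_def)
  also have "\<dots> \<le> a" using a assms(2) by (simp add: field_simps)
  finally have "t * (t * b) \<le> t * a" using t by simp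
  moreover have "2 * (t * a) \<le> t * (t * b)" using assms(1)[OF t] by (simp add: power2_eq_square mult_ac)
  moreover have "0 < t * a" using t a by simp
  ultimately show False by linarith
qed

context bounded_injective
begin

text \<open>Solvability of a linear system dual to the lower bound \<open>below\<close>. Minimise the squared error on \<open>F\<close> over
  the box of radius \<open>C\<close>, and let \<open>u\<close> be the error of the minimiser and \<open>p\<close> the adjoint of \<open>f\<close> applied to \<open>u\<close>. Moving
  towards the corner of the box given by the signs of \<open>p\<close> does not decrease the error, which gives
  \<open>C * (\<Sum>\<bar>p\<bar>) \<le> u 0 - (\<Sum>u\<^sup>2)\<close>. The lower bound applied to the adjoint gives
  \<open>u 0 \<le> C * (\<Sum>\<bar>p\<bar>)\<close>, so \<open>u = 0\<close>.\<close>

lemma delta_solvable_on_finite: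
  assumes below: "\<And>v M B \<beta>. (\<And>\<gamma>. \<bar>v \<gamma>\<bar> \<le> M) \<Longrightarrow> (\<And>\<gamma>. \<bar>(f \<star> v) \<gamma>\<bar> \<le> B) \<Longrightarrow> \<bar>v \<beta>\<bar> \<le> C * B"
    and "C > 0" "finite F" "0 \<in> F"
  shows "\<exists>w. (\<forall>\<gamma>. \<bar>w \<gamma>\<bar> \<le> C) \<and> (\<forall>\<gamma>\<in>F. (f \<star> w) \<gamma> = delta \<gamma>)"
proof -
  let ?box = "{w :: 'g \<Rightarrow> real. \<forall>\<gamma>. \<bar>w \<gamma>\<bar> \<le> C}"
  define \<Phi> where "\<Phi> w = (\<Sum>\<gamma>\<in>F. (delta \<gamma> - (f \<star> w) \<gamma>)\<^sup>2)" for w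
  have "0 \<in> ?box" using \<open>C > 0\<close> by simp
  then have "?box \<noteq> {}" by blast
  moreover have "continuous_on ?box \<Phi>"
    unfolding \<Phi>_def by (intro continuous_intros continuous_on_real_act)
  ultimately have "\<exists>w0\<in>?box. \<forall>w\<in>?box. \<Phi> w0 \<le> \<Phi> w"
    by (rule continuous_attains_inf[OF compact_box])
  then obtain w0 where w0: "w0 \<in> ?box" and min: "\<And>w. w \<in> ?box \<Longrightarrow> \<Phi> w0 \<le> \<Phi> w" by blast
  define u where "u = (\<lambda>\<gamma>. if \<gamma> \<in> F then delta \<gamma> - (f \<star> w0) \<gamma> else 0)"
  define v where "v = (\<lambda>\<gamma>. u (- \<gamma>))"
  define p where "p \<zeta> = (f \<star> v) (- \<zeta>)" for \<zeta>
  define S where "S = (\<lambda>(\<gamma>, \<eta>). \<gamma> + \<eta>) ` (F \<times> Poly_Mapping.keys f)"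
  have "finite S" using \<open>finite F\<close> by (simp add: S_def)
  have adj: "(\<Sum>\<gamma>\<in>F. u \<gamma> * (f \<star> w) \<gamma>) = (\<Sum>\<zeta>\<in>S. p \<zeta> * w \<zeta>)" for w
    unfolding p_def v_def S_def by (rule sum_act_adjoint) (simp_all add: \<open>finite F\<close> u_def)
  have p0: "p \<zeta> = 0" if "\<zeta> \<notin> S" for \<zeta>
    unfolding p_def v_def
    by (rule sum_act_adjoint(2)[of F]) (use that in \<open>simp_all add: \<open>finite F\<close> u_def S_def\<close>)
  define w1 where "w1 = (\<lambda>\<zeta>. C * sgn (p \<zeta>))"
  have w1: "w1 \<in> ?box" using \<open>C > 0\<close> by (simp add: w1_def abs_mult abs_sgn_eq)
  define D where "D \<gamma> = (f \<star> w1) \<gamma> - (f \<star> w0) \<gamma>" for \<gamma>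
  \<comment> \<open>First variation of the squared error along the segment from \<open>w0\<close> to the corner \<open>w1\<close>.\<close>
  have "(\<Sum>\<gamma>\<in>F. u \<gamma> * D \<gamma>) \<le> 0"
  proof (rule first_variation_nonpos)
    show "0 \<le> (\<Sum>\<gamma>\<in>F. (D \<gamma>)\<^sup>2)" by (simp add: sum_nonneg)
    fix t :: real assume t: "0 < t" "t \<le> 1"
    define wt where "wt = (\<lambda>\<gamma>. (1 - t) * w0 \<gamma> + t * w1 \<gamma>)"
    have "\<bar>wt \<gamma>\<bar> \<le> C" for \<gamma>
    proof -
      have "\<bar>wt \<gamma>\<bar> \<le> (1 - t) * \<bar>w0 \<gamma>\<bar> + t * \<bar>w1 \<gamma>\<bar>"
        unfolding wt_def using t by (intro abs_triangle_ineq[THEN order_trans]) (simp add: abs_mult)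
      also have "\<dots> \<le> (1 - t) * C + t * C"
        using t w0 w1 by (intro add_mono mult_left_mono) auto
      finally show ?thesis by (simp add: algebra_simps)
    qed
    then have "\<Phi> w0 \<le> \<Phi> wt" by (intro min) simp
    moreover have "\<Phi> w0 = (\<Sum>\<gamma>\<in>F. (u \<gamma>)\<^sup>2)"
      unfolding \<Phi>_def u_def by (intro sum.cong) auto
    moreover have fwt: "(f \<star> wt) \<gamma> = (f \<star> w0) \<gamma> + t * D \<gamma>" for \<gamma>
      by (simp add: act_def real_scale_def D_def wt_def sum.distrib sum_subtractf sum_distrib_left
          algebra_simps)
    have "\<Phi> wt = (\<Sum>\<gamma>\<in>F. (u \<gamma>)\<^sup>2 - 2 * t * (u \<gamma> * D \<gamma>) + t\<^sup>2 * (D \<gamma>)\<^sup>2)"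
      unfolding \<Phi>_def by (intro sum.cong) (auto simp: fwt u_def power2_eq_square algebra_simps)
    then have "\<Phi> wt = (\<Sum>\<gamma>\<in>F. (u \<gamma>)\<^sup>2) - 2 * t * (\<Sum>\<gamma>\<in>F. u \<gamma> * D \<gamma>) + t\<^sup>2 * (\<Sum>\<gamma>\<in>F. (D \<gamma>)\<^sup>2)"
      by (simp add: sum.distrib sum_subtractf sum_distrib_left)
    ultimately show "2 * t * (\<Sum>\<gamma>\<in>F. u \<gamma> * D \<gamma>) \<le> t\<^sup>2 * (\<Sum>\<gamma>\<in>F. (D \<gamma>)\<^sup>2)" by linarith
  qed
  moreover have "(\<Sum>\<gamma>\<in>F. u \<gamma> * D \<gamma>) = C * (\<Sum>\<zeta>\<in>S. \<bar>p \<zeta>\<bar>) - (\<Sum>\<gamma>\<in>F. u \<gamma> * (f \<star> w0) \<gamma>)"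
  proof -
    have "(\<Sum>\<gamma>\<in>F. u \<gamma> * D \<gamma>) = (\<Sum>\<gamma>\<in>F. u \<gamma> * (f \<star> w1) \<gamma>) - (\<Sum>\<gamma>\<in>F. u \<gamma> * (f \<star> w0) \<gamma>)"
      by (simp add: D_def right_diff_distrib sum_subtractf)
    also have "(\<Sum>\<gamma>\<in>F. u \<gamma> * (f \<star> w1) \<gamma>) = C * (\<Sum>\<zeta>\<in>S. \<bar>p \<zeta>\<bar>)"
      unfolding adj w1_def sum_distrib_left by (intro sum.cong) (auto simp: abs_sgn)
    finally show ?thesis .
  qed
  moreover have "(\<Sum>\<gamma>\<in>F. u \<gamma> * (f \<star> w0) \<gamma>) = u 0 - (\<Sum>\<gamma>\<in>F. (u \<gamma>)\<^sup>2)"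
  proof -
    have "(\<Sum>\<gamma>\<in>F. u \<gamma> * (f \<star> w0) \<gamma>) = (\<Sum>\<gamma>\<in>F. (if \<gamma> = 0 then u \<gamma> else 0) - (u \<gamma>)\<^sup>2)"
      by (intro sum.cong) (auto simp: u_def power2_eq_square algebra_simps)
    then show ?thesis using \<open>finite F\<close> \<open>0 \<in> F\<close> by (simp add: sum_subtractf)
  qed
  moreover have "u 0 \<le> C * (\<Sum>\<zeta>\<in>S. \<bar>p \<zeta>\<bar>)"
  proof -
    have "\<bar>v 0\<bar> \<le> C * (\<Sum>\<zeta>\<in>S. \<bar>p \<zeta>\<bar>)"
    proof (rule below)
      show "\<bar>v \<gamma>\<bar> \<le> (\<Sum>\<gamma>\<in>F. \<bar>u \<gamma>\<bar>)" for \<gamma>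
      proof (cases "- \<gamma> \<in> F")
        case True
        then show ?thesis unfolding v_def
          using \<open>finite F\<close> by (intro member_le_sum[where f = "\<lambda>\<gamma>. \<bar>u \<gamma>\<bar>"]) auto
      qed (simp add: v_def u_def sum_nonneg)
      show "\<bar>(f \<star> v) \<gamma>\<bar> \<le> (\<Sum>\<zeta>\<in>S. \<bar>p \<zeta>\<bar>)" for \<gamma>
      proof (cases "- \<gamma> \<in> S")
        case True
        then have "\<bar>p (- \<gamma>)\<bar> \<le> (\<Sum>\<zeta>\<in>S. \<bar>p \<zeta>\<bar>)"
          using \<open>finite S\<close> by (intro member_le_sum[where f = "\<lambda>\<gamma>. \<bar>p \<gamma>\<bar>"]) auto
        then show ?thesis by (simp add: p_def)
      next
        case False
        then have "(f \<star> v) \<gamma> = 0" using p0[of "- \<gamma>"] by (simp add: p_def)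
        then show ?thesis by (simp add: sum_nonneg)
      qed
    qed
    then show ?thesis by (simp add: v_def)
  qed
  ultimately have "(\<Sum>\<gamma>\<in>F. (u \<gamma>)\<^sup>2) \<le> 0" by linarith
  then have "(\<Sum>\<gamma>\<in>F. (u \<gamma>)\<^sup>2) = 0" by (intro antisym) (simp_all add: sum_nonneg)
  then have "\<forall>\<gamma>\<in>F. u \<gamma> = 0" using \<open>finite F\<close> by (simp add: sum_nonneg_eq_0_iff)
  then have "\<forall>\<gamma>\<in>F. (f \<star> w0) \<gamma> = delta \<gamma>" by (simp add: u_def)
  then show ?thesis using w0 by blast
qed

text \<open>Compactness of the box passes from finitely many equations to all of them. Away from \<open>0\<close> the
  equation is \<open>f \<star> w = 0\<close>, so the local estimate makes \<open>w\<close> small at every point whose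
  test window misses \<open>0\<close>, that is, at all but finitely many points.\<close>

lemma fundamental_solution:
  obtains w where "vanishing w" "f \<star> w = delta" "bounded (range w)"
proof -
  obtain C where "C > 0" and
    below: "\<And>v M B \<beta>. (\<And>\<gamma>. \<bar>v \<gamma>\<bar> \<le> M) \<Longrightarrow> (\<And>\<gamma>. \<bar>(f \<star> v) \<gamma>\<bar> \<le> B) \<Longrightarrow> \<bar>v \<beta>\<bar> \<le> C * B"
    using bounded_below by metis
  let ?box = "{w :: 'g \<Rightarrow> real. \<forall>\<gamma>. \<bar>w \<gamma>\<bar> \<le> C}"
  let ?W = "\<lambda>\<gamma>. {w. (f \<star> w) \<gamma> = delta \<gamma>}"
  have "?box \<inter> (\<Inter>\<gamma>\<in>UNIV. ?W \<gamma>) \<noteq> {}"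
  proof (rule compact_imp_fip_image[OF compact_box])
    show "closed (?W \<gamma>)" for \<gamma>
      by (intro closed_Collect_eq continuous_intros continuous_on_real_act)
    fix F :: "'g set" assume "finite F"
    have "\<exists>w. (\<forall>\<gamma>. \<bar>w \<gamma>\<bar> \<le> C) \<and> (\<forall>\<gamma>\<in>insert 0 F. (f \<star> w) \<gamma> = delta \<gamma>)"
    proof (rule delta_solvable_on_finite)
      show "\<bar>v \<beta>\<bar> \<le> C * B" if "\<And>\<gamma>. \<bar>v \<gamma>\<bar> \<le> M" "\<And>\<gamma>. \<bar>(f \<star> v) \<gamma>\<bar> \<le> B" for v M B \<beta>
        using that by (rule below)
    qed (use \<open>C > 0\<close> \<open>finite F\<close> in simp_all)
    then show "?box \<inter> (\<Inter>\<gamma>\<in>F. ?W \<gamma>) \<noteq> {}" by auto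
  qed
  then obtain w where box: "\<And>\<gamma>. \<bar>w \<gamma>\<bar> \<le> C" and w: "f \<star> w = delta" by (auto simp: fun_eq_iff)
  have "vanishing w"
    unfolding vanishing_def
  proof (intro allI impI)
    fix \<epsilon> :: real assume "0 < \<epsilon>"
    then obtain E c where "finite E" "c > 0" and
      ctl: "\<And>v \<beta>. (\<And>\<gamma>. \<bar>v \<gamma>\<bar> \<le> C) \<Longrightarrow> (\<And>\<gamma>. \<gamma> \<in> E \<Longrightarrow> \<bar>(f \<star> v) (\<beta> + \<gamma>)\<bar> < c) \<Longrightarrow> \<bar>v \<beta>\<bar> < \<epsilon>"
      using local_control_at by metis
    have "{\<gamma>. \<epsilon> \<le> dist (w \<gamma>) 0} \<subseteq> uminus ` E"
    proof (rule subsetI, rule ccontr)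
      fix \<beta> assume big: "\<beta> \<in> {\<gamma>. \<epsilon> \<le> dist (w \<gamma>) 0}" and out: "\<beta> \<notin> uminus ` E"
      have "\<bar>w \<beta>\<bar> < \<epsilon>"
      proof (rule ctl[OF box])
        fix \<gamma> assume "\<gamma> \<in> E"
        then have "\<beta> + \<gamma> \<noteq> 0" using out by (metis add_eq_0_iff2 image_eqI)
        then show "\<bar>(f \<star> w) (\<beta> + \<gamma>)\<bar> < c" using \<open>c > 0\<close> by (simp add: w)
      qed
      then show False using big by simp
    qed
    then show "finite {\<gamma>. \<epsilon> \<le> dist (w \<gamma>) 0}" using \<open>finite E\<close> finite_surj by blast
  qed
  moreover have "bounded (range w)" using box by (auto simp: bounded_iff)
  ultimately show thesis using w that by blast
qed

end

section \<open>Compatible metrics in terms of coordinates\<close>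

text \<open>The common pattern of the two comparisons below, with \<open>K\<close> the square of the system and \<open>p\<close>, \<open>q\<close>
  two measures of closeness: on the compact set where \<open>p \<ge> \<epsilon>\<close>, the function \<open>q\<close> has a positive minimum.\<close>

lemma compact_uniform_comparison:
  fixes p q :: "'a::t2_space \<Rightarrow> real"
  assumes K: "compact K" and p: "continuous_on K p" and q: "continuous_on K q"
    and zero: "\<And>z. z \<in> K \<Longrightarrow> q z \<le> 0 \<Longrightarrow> p z \<le> 0" and "\<epsilon> > 0"
  obtains \<delta> where "\<delta> > 0" "\<And>z. z \<in> K \<Longrightarrow> q z < \<delta> \<Longrightarrow> p z < \<epsilon>"
proof -
  define K' where "K' = K \<inter> p -` {\<epsilon>..}"
  have "closed K'"
    unfolding K'_def by (rule continuous_closed_preimage[OF p compact_imp_closed[OF K] closed_atLeast])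
  then have "compact K'"
    using compact_Int_closed[OF K, of K'] by (simp add: K'_def Int_assoc[symmetric])
  show thesis
  proof (cases "K' = {}")
    case True
    then have "p z < \<epsilon>" if "z \<in> K" for z using that by (force simp: K'_def)
    then show thesis using that[of 1] by simp
  next
    case False
    moreover have "continuous_on K' q" using q by (rule continuous_on_subset) (simp add: K'_def)
    ultimately have "\<exists>z0\<in>K'. \<forall>z\<in>K'. q z0 \<le> q z"
      using \<open>compact K'\<close> by (intro continuous_attains_inf)
    then obtain z0 where z0: "z0 \<in> K'" "\<And>z. z \<in> K' \<Longrightarrow> q z0 \<le> q z" by blast
    have "q z0 > 0" using zero[of z0] z0(1) \<open>\<epsilon> > 0\<close> by (force simp: K'_def)
    moreover have "p z < \<epsilon>" if "z \<in> K" "q z < q z0" for z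
      using z0(2)[of z] that by (force simp: K'_def)
    ultimately show thesis by (rule that)
  qed
qed

lemma continuous_on_compatible_metric:
  assumes "compatible_metric X d"
  shows "continuous_on (X \<times> X) (\<lambda>z. d (fst z) (snd z))"
proof -
  interpret Metric_space X d using assms by (simp add: compatible_metric_def)
  have top: "mtopology = top_of_set X" using assms by (simp add: compatible_metric_def)
  have nbhd: "\<exists>T. open T \<and> x \<in> T \<and> (\<forall>x'\<in>T \<inter> X. d x x' < r)" if "x \<in> X" "0 < r" for x r
  proof -
    have "openin (top_of_set X) (mball x r)" using openin_mball[of x r] top by simp
    then obtain T where T: "open T" "mball x r = X \<inter> T" unfolding openin_open by metis
    have "x \<in> mball x r" using that by simp
    then have "x \<in> T" using T(2) by blast
    moreover have "d x x' < r" if "x' \<in> T \<inter> X" for x'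
      using that T(2) in_mball[of x' x r] by blast
    ultimately show ?thesis using T(1) by metis
  qed
  show ?thesis
    unfolding continuous_on_def
  proof (intro ballI tendstoI)
    fix z and \<epsilon> :: real assume z: "z \<in> X \<times> X" and "0 < \<epsilon>"
    obtain x y where xy: "z = (x, y)" "x \<in> X" "y \<in> X" using z by blast
    obtain S T where S: "open S" "x \<in> S" "\<forall>x'\<in>S \<inter> X. d x x' < \<epsilon> / 2"
      and T: "open T" "y \<in> T" "\<forall>y'\<in>T \<inter> X. d y y' < \<epsilon> / 2"
      using nbhd[OF xy(2), of "\<epsilon> / 2"] nbhd[OF xy(3), of "\<epsilon> / 2"] \<open>0 < \<epsilon>\<close> by auto
    have "dist (d x' y') (d x y) < \<epsilon>" if "x' \<in> S \<inter> X" "y' \<in> T \<inter> X" for x' y'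
    proof -
      have "d x x' < \<epsilon> / 2" "d y y' < \<epsilon> / 2" using that S T by blast+
      moreover have "d x' y' \<le> d x' x + d x y + d y y'" "d x y \<le> d x x' + d x' y' + d y' y"
        using triangle[of x' x y'] triangle[of x y y'] triangle[of x x' y] triangle[of x' y' y] that xy
        by auto
      ultimately show ?thesis using commute[of x x'] commute[of y y'] by (simp add: dist_real_def)
    qed
    then show "\<forall>\<^sub>F z' in at z within X \<times> X. dist (d (fst z') (snd z')) (d (fst z) (snd z)) < \<epsilon>"
      unfolding eventually_at_topological
      by (intro exI[of _ "S \<times> T"]) (use S T xy in \<open>auto intro: open_Times\<close>)
  qed
qed

lemma dist_fun_small:
  assumes "\<epsilon> > 0"
  obtains F \<delta> where "finite F" "\<delta> > 0"
    "\<And>x y :: 'g::countable \<Rightarrow> 'a::metric_space. (\<And>\<eta>. \<eta> \<in> F \<Longrightarrow> dist (x \<eta>) (y \<eta>) < \<delta>) \<Longrightarrow> dist x y < \<epsilon>"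
proof -
  obtain N where N: "(1/2)^N < \<epsilon> / 2"
    using real_arch_pow_inv[of "\<epsilon> / 2" "1/2"] assms by auto
  show thesis
  proof
    show "finite (from_nat ` {..N} :: 'g set)" "\<epsilon> / 4 > 0" using assms by simp_all
    fix x y :: "'g \<Rightarrow> 'a"
    assume "\<And>\<eta>. \<eta> \<in> from_nat ` {..N} \<Longrightarrow> dist (x \<eta>) (y \<eta>) < \<epsilon> / 4"
    then have "dist (x (from_nat n)) (y (from_nat n)) < \<epsilon> / 4" if "n \<le> N" for n using that by simp
    then have "Max {dist (x (from_nat n)) (y (from_nat n))|n. n \<le> N} < \<epsilon> / 4"
      by (subst Max_less_iff) auto
    then show "dist x y < \<epsilon>" using dist_fun_le_dist_first_terms[of x y N] N by linarith
  qed
qed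

lemma compatible_metric_coordinate:
  fixes X :: "('g::countable \<Rightarrow> circle) set"
  assumes "compact X" and d: "compatible_metric X d" and "\<epsilon> > 0"
  obtains \<delta> where "\<delta> > 0" "\<And>x y. x \<in> X \<Longrightarrow> y \<in> X \<Longrightarrow> d x y < \<delta> \<Longrightarrow> dist (x \<gamma>) (y \<gamma>) < \<epsilon>"
proof -
  interpret Metric_space X d using d by (simp add: compatible_metric_def)
  have coord: "continuous_on A (\<lambda>x. x \<gamma>)" for A :: "('g \<Rightarrow> circle) set"
    by (rule continuous_on_subset[OF continuous_on_product_coordinates]) simp
  have cont: "continuous_on (X \<times> X) (\<lambda>z. dist (fst z \<gamma>) (snd z \<gamma>))"
    by (intro continuous_on_dist continuous_on_compose2[OF coord[of UNIV]] continuous_intros) auto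
  obtain \<delta> where "\<delta> > 0"
    "\<And>z. z \<in> X \<times> X \<Longrightarrow> d (fst z) (snd z) < \<delta> \<Longrightarrow> dist (fst z \<gamma>) (snd z \<gamma>) < \<epsilon>"
  proof (rule compact_uniform_comparison[OF compact_Times[OF \<open>compact X\<close> \<open>compact X\<close>] cont
        continuous_on_compatible_metric[OF d] _ \<open>\<epsilon> > 0\<close>])
    show "dist (fst z \<gamma>) (snd z \<gamma>) \<le> 0" if "z \<in> X \<times> X" "d (fst z) (snd z) \<le> 0" for z
    proof -
      have "d (fst z) (snd z) = 0" using that(2) nonneg[of "fst z" "snd z"] by (rule antisym)
      then have "fst z = snd z" using that(1) by (subst (asm) zero) auto
      then show ?thesis by simp
    qed
  qed blast
  then show thesis using that by (metis SigmaI fst_conv snd_conv)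
qed

lemma compatible_metric_small:
  fixes X :: "('g::countable \<Rightarrow> circle) set"
  assumes "compact X" and d: "compatible_metric X d" and "\<epsilon> > 0"
  obtains F \<delta> where "finite F" "\<delta> > 0"
    "\<And>x y. x \<in> X \<Longrightarrow> y \<in> X \<Longrightarrow> (\<And>\<eta>. \<eta> \<in> F \<Longrightarrow> dist (x \<eta>) (y \<eta>) < \<delta>) \<Longrightarrow> d x y < \<epsilon>"
proof -
  interpret Metric_space X d using d by (simp add: compatible_metric_def)
  have "continuous_on (X \<times> X) (\<lambda>z. dist (fst z) (snd z))" by (intro continuous_intros)
  then obtain \<delta>' where "\<delta>' > 0"
    and \<delta>': "\<And>z. z \<in> X \<times> X \<Longrightarrow> dist (fst z) (snd z) < \<delta>' \<Longrightarrow> d (fst z) (snd z) < \<epsilon>"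
  proof (rule compact_uniform_comparison[OF compact_Times[OF \<open>compact X\<close> \<open>compact X\<close>]
        continuous_on_compatible_metric[OF d]])
    show "d (fst z) (snd z) \<le> 0" if "z \<in> X \<times> X" "dist (fst z) (snd z) \<le> 0" for z
      using that by auto
  qed (use assms in auto)
  obtain F \<delta> where F: "finite F" "\<delta> > 0"
    "\<And>x y :: 'g \<Rightarrow> circle. (\<And>\<eta>. \<eta> \<in> F \<Longrightarrow> dist (x \<eta>) (y \<eta>) < \<delta>) \<Longrightarrow> dist x y < \<delta>'"
    using dist_fun_small[OF \<open>\<delta>' > 0\<close>] by metis
  have "d x y < \<epsilon>" if "x \<in> X" "y \<in> X" "\<And>\<eta>. \<eta> \<in> F \<Longrightarrow> dist (x \<eta>) (y \<eta>) < \<delta>" for x y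
    using \<delta>'[of "(x, y)"] F(3)[of x y] that by simp
  then show thesis using F(1,2) that by blast
qed

text \<open>In particular homoclinicity is invariant under translation, although \<open>d\<close> need not be.\<close>

lemma homoclinic_iff_vanishing:
  fixes f :: "'g::{ab_group_add, countable} \<Rightarrow>\<^sub>0 int"
  assumes d: "compatible_metric (principal_system f) d"
    and x: "x \<in> principal_system f" and y: "y \<in> principal_system f"
  shows "homoclinic d shift x y \<longleftrightarrow> vanishing (x - y)"
proof
  let ?X = "principal_system f"
  note K = compact_principal_system[of f]
  assume h: "homoclinic d shift x y"
  show "vanishing (x - y)"
    unfolding vanishing_def
  proof (intro allI impI)
    fix \<epsilon> :: real assume "0 < \<epsilon>"
    then obtain \<delta> where "\<delta> > 0" and
      \<delta>: "\<And>x y. x \<in> ?X \<Longrightarrow> y \<in> ?X \<Longrightarrow> d x y < \<delta> \<Longrightarrow> dist (x 0) (y 0) < \<epsilon>"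
      using compatible_metric_coordinate[OF K d] by metis
    obtain F where F: "finite F" "\<And>\<gamma>. \<gamma> \<notin> F \<Longrightarrow> d (shift \<gamma> x) (shift \<gamma> y) < \<delta>"
      using h \<open>\<delta> > 0\<close> unfolding homoclinic_def by metis
    have "{\<gamma>. \<epsilon> \<le> dist ((x - y) \<gamma>) 0} \<subseteq> uminus ` F"
    proof (rule subsetI, rule ccontr)
      fix \<gamma> assume big: "\<gamma> \<in> {\<gamma>. \<epsilon> \<le> dist ((x - y) \<gamma>) 0}" and "\<gamma> \<notin> uminus ` F"
      then have "- \<gamma> \<notin> F" by (metis image_eqI minus_minus)
      then have "dist (shift (- \<gamma>) x 0) (shift (- \<gamma>) y 0) < \<epsilon>"
        using F(2) x y by (intro \<delta> shift_principal_system)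
      then show False using big by (simp add: shift_def dist_circle_eq[of "x _"])
    qed
    then show "finite {\<gamma>. \<epsilon> \<le> dist ((x - y) \<gamma>) 0}" using F(1) finite_surj by blast
  qed
next
  let ?X = "principal_system f"
  note K = compact_principal_system[of f]
  assume v: "vanishing (x - y)"
  show "homoclinic d shift x y"
    unfolding homoclinic_def
  proof (intro allI impI)
    fix \<epsilon> :: real assume "0 < \<epsilon>"
    then obtain F \<delta> where F: "finite F" "\<delta> > 0" and
      \<delta>: "\<And>x y. x \<in> ?X \<Longrightarrow> y \<in> ?X \<Longrightarrow> (\<And>\<eta>. \<eta> \<in> F \<Longrightarrow> dist (x \<eta>) (y \<eta>) < \<delta>) \<Longrightarrow> d x y < \<epsilon>"
      using compatible_metric_small[OF K d] by metis
    define B where "B = {\<gamma>. \<delta> \<le> dist ((x - y) \<gamma>) 0}"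
    define G where "G = (\<lambda>(\<eta>, \<beta>). \<eta> - \<beta>) ` (F \<times> B)"
    have "finite B" using v \<open>\<delta> > 0\<close> by (simp add: vanishing_def B_def)
    then have "finite G" using F(1) by (simp add: G_def)
    moreover have "d (shift \<gamma> x) (shift \<gamma> y) < \<epsilon>" if "\<gamma> \<notin> G" for \<gamma>
    proof (intro \<delta> shift_principal_system x y)
      fix \<eta> assume "\<eta> \<in> F"
      have "- \<gamma> + \<eta> \<notin> B"
      proof
        assume "- \<gamma> + \<eta> \<in> B"
        then have "(\<lambda>(\<eta>, \<beta>). \<eta> - \<beta>) (\<eta>, - \<gamma> + \<eta>) \<in> G" using \<open>\<eta> \<in> F\<close> unfolding G_def by blast
        then show False using that by simp
      qed
      then show "dist (shift \<gamma> x \<eta>) (shift \<gamma> y \<eta>) < \<delta>"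
        by (simp add: B_def shift_def dist_circle_eq[of "x _"])
    qed
    ultimately show "\<exists>F. finite F \<and> (\<forall>\<gamma>. \<gamma> \<notin> F \<longrightarrow> d (shift \<gamma> x) (shift \<gamma> y) < \<epsilon>)" by blast
  qed
qed

text \<open>If \<open>f \<star> v = 0\<close> with \<open>v\<close> bounded and nonzero, then \<open>t * v\<close> modulo 1 is, for small \<open>t > 0\<close>, a nonzero
  point of the system whose orbit stays in a prescribed neighbourhood of \<open>0\<close>.\<close>

lemma expansive_imp_bounded_injective:
  fixes f :: "'g::{ab_group_add, countable} \<Rightarrow>\<^sub>0 int"
  assumes d: "compatible_metric (principal_system f) d"
    and e: "expansive (principal_system f) d shift"
  shows "bounded_injective f"
proof
  let ?X = "principal_system f"
  fix v :: "'g \<Rightarrow> real" and M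
  assume M: "\<And>\<gamma>. \<bar>v \<gamma>\<bar> \<le> M" and fv: "f \<star> v = 0"
  obtain \<epsilon> where "\<epsilon> > 0" and
    \<epsilon>: "\<And>x y. x \<in> ?X \<Longrightarrow> y \<in> ?X \<Longrightarrow> x \<noteq> y \<Longrightarrow> \<exists>\<gamma>. d (shift \<gamma> x) (shift \<gamma> y) \<ge> \<epsilon>"
    using e unfolding expansive_def by blast
  obtain F \<delta> where F: "finite F" "\<delta> > 0" and
    \<delta>: "\<And>x y. x \<in> ?X \<Longrightarrow> y \<in> ?X \<Longrightarrow> (\<And>\<eta>. \<eta> \<in> F \<Longrightarrow> dist (x \<eta>) (y \<eta>) < \<delta>) \<Longrightarrow> d x y < \<epsilon>"
    using compatible_metric_small[OF compact_principal_system[of f] d \<open>\<epsilon> > 0\<close>] by metis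
  show "v = 0"
  proof (rule ccontr)
    assume "v \<noteq> 0"
    then obtain \<beta> where \<beta>: "v \<beta> \<noteq> 0" by (auto simp: fun_eq_iff)
    then have "M > 0" using M[of \<beta>] by linarith
    define t where "t = min \<delta> 1 / (2 * M)"
    have "t > 0" using \<open>M > 0\<close> \<open>\<delta> > 0\<close> by (simp add: t_def)
    define u where "u = (\<lambda>\<gamma>. t * v \<gamma>)"
    have "\<bar>u \<gamma>\<bar> \<le> min \<delta> 1 / 2" for \<gamma>
    proof -
      have "\<bar>u \<gamma>\<bar> = t * \<bar>v \<gamma>\<bar>" using \<open>t > 0\<close> by (simp add: u_def abs_mult)
      also have "\<dots> \<le> t * M" using M \<open>t > 0\<close> by (intro mult_left_mono) auto
      also have "\<dots> = min \<delta> 1 / 2" using \<open>M > 0\<close> by (simp add: t_def)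
      finally show ?thesis .
    qed
    moreover have "min \<delta> 1 / 2 < \<delta>" "min \<delta> 1 / 2 < 1" using \<open>\<delta> > 0\<close> by (simp_all add: min_def)
    ultimately have small: "\<bar>u \<gamma>\<bar> < \<delta>" "\<bar>u \<gamma>\<bar> < 1" for \<gamma> by (meson le_less_trans)+
    have "f \<star> u = 0"
    proof
      fix \<gamma>
      have "(f \<star> u) \<gamma> = t * (f \<star> v) \<gamma>"
        by (simp add: act_def u_def real_scale_def sum_distrib_left mult_ac)
      then show "(f \<star> u) \<gamma> = 0 \<gamma>" by (simp add: fv)
    qed
    then have "proj u \<in> ?X" by (simp add: mem_principal_system proj_act[symmetric]) (simp add: proj_def fun_eq_iff)
    have "proj u = 0"
    proof (rule ccontr)
      assume "proj u \<noteq> 0"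
      then obtain \<gamma> where "d (shift \<gamma> (proj u)) (shift \<gamma> 0) \<ge> \<epsilon>"
        using \<epsilon> \<open>proj u \<in> ?X\<close> principal_system_zero by blast
      moreover have "d (shift \<gamma> (proj u)) (shift \<gamma> 0) < \<epsilon>"
      proof (intro \<delta> shift_principal_system \<open>proj u \<in> ?X\<close> principal_system_zero)
        fix \<eta>
        show "dist (shift \<gamma> (proj u) \<eta>) (shift \<gamma> 0 \<eta>) < \<delta>"
          using dist_abs_circle_le[of "u (- \<gamma> + \<eta>)" 0] small(1)[of "- \<gamma> + \<eta>"]
          by (simp add: shift_def proj_def)
      qed
      ultimately show False by linarith
    qed
    then have "u \<beta> \<in> \<int>" by (simp add: proj_eq_0_iff)
    moreover have "u \<beta> \<noteq> 0" using \<beta> \<open>t > 0\<close> by (simp add: u_def)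
    ultimately show False using Ints_nonzero_abs_ge1[of "u \<beta>"] small(2)[of \<beta>] by linarith
  qed
qed

section \<open>Endomorphisms are affine\<close>

lemma continuous_on_translate:
  "continuous_on A (\<lambda>x :: 'g \<Rightarrow> circle. x + y)"
  by (rule continuous_on_coordinatewise_then_product)
    (auto intro!: continuous_intros continuous_on_subset[OF continuous_on_product_coordinates])

text \<open>For small \<open>y\<close> the increment of \<open>\<phi>\<close> is uniformly small and lifts through \<open>small_rep\<close>. The lift for
  \<open>y + z\<close> is the sum of a translated lift for \<open>y\<close> and a lift for \<open>z\<close>, so lifts propagate along chains of
  small steps; such chains reach everything since \<open>X\<close> is connected, in a bounded number of steps
  since \<open>X\<close> is compact.\<close>

lemma increment_lifts:
  fixes X :: "('g::countable \<Rightarrow> circle) set" and \<phi> :: "('g \<Rightarrow> circle) \<Rightarrow> circle"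
  assumes "compact X" "connected X" "0 \<in> X"
    and add: "\<And>x y. x \<in> X \<Longrightarrow> y \<in> X \<Longrightarrow> x + y \<in> X"
    and diff: "\<And>x y. x \<in> X \<Longrightarrow> y \<in> X \<Longrightarrow> x - y \<in> X"
    and \<phi>: "continuous_on X \<phi>"
  obtains C where "\<And>y. y \<in> X \<Longrightarrow>
    \<exists>k. continuous_on X k \<and> (\<forall>x\<in>X. \<bar>k x\<bar> \<le> C \<and> abs_circle (k x) = \<phi> (x + y) - \<phi> x)"
proof -
  \<comment> \<open>The bound counts the small steps that lead from \<open>0\<close> to \<open>y\<close>.\<close>
  define lifts where "lifts n y \<longleftrightarrow> (\<exists>k. continuous_on X k \<and>
    (\<forall>x\<in>X. \<bar>k x\<bar> \<le> real n \<and> abs_circle (k x) = \<phi> (x + y) - \<phi> x))" for n y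
  have "uniformly_continuous_on X \<phi>"
    using \<phi> \<open>compact X\<close> by (rule compact_uniformly_continuous)
  then obtain \<delta> where "\<delta> > 0" and
    \<delta>: "\<And>x x'. x \<in> X \<Longrightarrow> x' \<in> X \<Longrightarrow> dist x' x < \<delta> \<Longrightarrow> dist (\<phi> x') (\<phi> x) < 1/4"
    unfolding uniformly_continuous_on_def by (metis zero_less_divide_1_iff zero_less_numeral)
  have cont_shifted: "continuous_on X (\<lambda>x. \<phi> (x + y))" if "y \<in> X" for y
    by (rule continuous_on_compose2[OF \<phi> continuous_on_translate]) (use add that in auto)
  have near: "lifts 1 y" if y: "y \<in> X" "dist y 0 < \<delta>" for y
  proof -
    define k where "k x = small_rep (\<phi> (x + y) - \<phi> x)" for x
    have small: "dist (\<phi> (x + y) - \<phi> x) 0 < 1/4" if "x \<in> X" for x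
    proof -
      have "dist (x + y) x = dist y 0" using dist_fun_translate[of y x 0] by (simp add: add.commute)
      then have "dist (\<phi> (x + y)) (\<phi> x) < 1/4" using \<delta> add that y by simp
      then show ?thesis by (simp add: dist_circle_eq[of "\<phi> (x + y)"])
    qed
    have "continuous_on X k"
      unfolding k_def
      by (rule continuous_on_compose2[OF continuous_on_small_rep])
        (use small in \<open>auto intro!: continuous_intros cont_shifted y \<phi>\<close>)
    moreover have "\<bar>k x\<bar> \<le> real 1 \<and> abs_circle (k x) = \<phi> (x + y) - \<phi> x" for x
      by (simp add: k_def abs_small_rep_le)
    ultimately show ?thesis unfolding lifts_def by blast
  qed
  have lifts_add: "lifts (m + n) (y + z)" if "lifts m y" "lifts n z" "y \<in> X" "z \<in> X" for m n y z
  proof -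
    obtain k l where k: "continuous_on X k"
        "\<And>x. x \<in> X \<Longrightarrow> \<bar>k x\<bar> \<le> real m" "\<And>x. x \<in> X \<Longrightarrow> abs_circle (k x) = \<phi> (x + y) - \<phi> x"
      and l: "continuous_on X l"
        "\<And>x. x \<in> X \<Longrightarrow> \<bar>l x\<bar> \<le> real n" "\<And>x. x \<in> X \<Longrightarrow> abs_circle (l x) = \<phi> (x + z) - \<phi> x"
      using \<open>lifts m y\<close> \<open>lifts n z\<close> unfolding lifts_def by blast
    have "continuous_on X (\<lambda>x. k (x + z) + l x)"
      by (intro continuous_intros l(1) continuous_on_compose2[OF k(1) continuous_on_translate])
        (use add \<open>z \<in> X\<close> in auto)
    moreover have "\<bar>k (x + z) + l x\<bar> \<le> real (m + n)" if "x \<in> X" for x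
      using k(2)[of "x + z"] l(2)[of x] add that \<open>z \<in> X\<close> by fastforce
    moreover have "abs_circle (k (x + z) + l x) = \<phi> (x + (y + z)) - \<phi> x" if "x \<in> X" for x
      using k(3)[of "x + z"] l(3)[of x] add that \<open>z \<in> X\<close> by (simp add: abs_circle_add ac_simps)
    ultimately show ?thesis unfolding lifts_def by blast
  qed
  have step: "lifts (Suc n) y'" if "lifts n y" "y \<in> X" "y' \<in> X" "dist y' y < \<delta>" for n y y'
  proof -
    have "dist (y' - y) 0 = dist y' y" using dist_fun_translate[of "y' - y" y 0] by simp
    then have "lifts 1 (y' - y)" using that diff by (intro near) auto
    from lifts_add[OF \<open>lifts n y\<close> this] show ?thesis using that diff by simp
  qed
  define Y where "Y = {y \<in> X. \<exists>n. lifts n y}"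
  have "openin (top_of_set X) Y"
    unfolding openin_euclidean_subtopology_iff
  proof (intro conjI ballI)
    fix y assume "y \<in> Y"
    then show "\<exists>e>0. \<forall>y'\<in>X. dist y' y < e \<longrightarrow> y' \<in> Y"
      using step \<open>\<delta> > 0\<close> unfolding Y_def by blast
  qed (auto simp: Y_def)
  moreover have "openin (top_of_set X) (X - Y)"
    unfolding openin_euclidean_subtopology_iff
  proof (intro conjI ballI)
    fix y assume y: "y \<in> X - Y"
    have "y' \<in> X - Y" if "y' \<in> X" "dist y' y < \<delta>" for y'
      using step[of _ y' y] that y unfolding Y_def by (auto simp: dist_commute)
    then show "\<exists>e>0. \<forall>y'\<in>X. dist y' y < e \<longrightarrow> y' \<in> X - Y" using \<open>\<delta> > 0\<close> by blast
  qed auto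
  then have "closedin (top_of_set X) Y"
    by (simp add: closedin_def Y_def)
  moreover have "0 \<in> Y" using near[of 0] \<open>0 \<in> X\<close> \<open>\<delta> > 0\<close> unfolding Y_def by auto
  ultimately have "Y = X" using \<open>connected X\<close> unfolding connected_clopen by blast
  then have "\<forall>y\<in>X. \<exists>n. lifts n y" by (auto simp: Y_def)
  then obtain N where N: "\<And>y. y \<in> X \<Longrightarrow> lifts (N y) y" by metis
  have cover: "X \<subseteq> (\<Union>c\<in>X. ball c \<delta>)" using \<open>\<delta> > 0\<close> by auto
  obtain D where D: "D \<subseteq> X" "finite D" "X \<subseteq> (\<Union>c\<in>D. ball c \<delta>)"
    by (rule compactE_image[OF \<open>compact X\<close> _ cover]) auto
  show thesis
  proof
    fix y assume "y \<in> X"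
    then obtain c where c: "c \<in> D" "dist y c < \<delta>" using D by (auto simp: dist_commute)
    then have "lifts (Suc (N c)) y" using step[of "N c" c y] N D \<open>y \<in> X\<close> by blast
    moreover have "N c \<le> (\<Sum>c\<in>D. N c)" using D c by (intro member_le_sum) auto
    ultimately show "\<exists>k. continuous_on X k \<and>
        (\<forall>x\<in>X. \<bar>k x\<bar> \<le> real (Suc (\<Sum>c\<in>D. N c)) \<and> abs_circle (k x) = \<phi> (x + y) - \<phi> x)"
      unfolding lifts_def by (smt (verit) Suc_le_mono of_nat_mono)
  qed
qed

lemma continuous_integer_valued_constant:
  fixes k :: "'a::topological_space \<Rightarrow> real"
  assumes "connected X" "continuous_on X k" "\<And>x. x \<in> X \<Longrightarrow> k x \<in> \<int>" "x \<in> X" "y \<in> X"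
  shows "k x = k y"
proof -
  have "k constant_on X"
  proof (rule continuous_discrete_range_constant[OF assms(1,2)])
    fix x assume x: "x \<in> X"
    have "1 \<le> norm (k y - k x)" if "y \<in> X" "k y \<noteq> k x" for y
      using Ints_nonzero_abs_ge1[of "k y - k x"] assms(3) x that by auto
    then show "\<exists>e>0. \<forall>y. y \<in> X \<and> k y \<noteq> k x \<longrightarrow> e \<le> norm (k y - k x)"
      by (intro exI[of _ 1]) auto
  qed
  then show ?thesis using assms(4,5) by (auto simp: constant_on_def)
qed

text \<open>The bound \<open>C\<close> of the lifts at the
  coordinate \<open>0\<close> is uniform in \<open>y\<close>; this is what makes it valid at the coordinate \<open>\<gamma>\<close>, where
  equivariance replaces \<open>y\<close> by a translate.\<close>

lemma endomorphism_affine: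
  fixes f :: "'g::{ab_group_add, countable} \<Rightarrow>\<^sub>0 int"
  assumes "bounded_injective f" and conn: "connected (principal_system f)"
    and \<tau>: "endomorphism (principal_system f) shift \<tau>"
    and x: "x \<in> principal_system f" and y: "y \<in> principal_system f"
  shows "\<tau> (x + y) = \<tau> x + \<tau> y - \<tau> 0"
proof -
  interpret bounded_injective f by fact
  let ?X = "principal_system f"
  have \<tau>X: "\<tau> x \<in> ?X" if "x \<in> ?X" for x using \<tau> that by (auto simp: endomorphism_def)
  have \<tau>_shift: "\<tau> (shift \<gamma> x) = shift \<gamma> (\<tau> x)" if "x \<in> ?X" for \<gamma> x
    using \<tau> that by (simp add: endomorphism_def)
  have "continuous_on ?X \<tau>" using \<tau> by (simp add: endomorphism_def)
  then have "continuous_on ?X (\<lambda>x. \<tau> x 0)" by (rule continuous_on_product_then_coordinatewise)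
  then obtain C where C: "\<And>y. y \<in> ?X \<Longrightarrow>
    \<exists>k. continuous_on ?X k \<and> (\<forall>x\<in>?X. \<bar>k x\<bar> \<le> C \<and> abs_circle (k x) = \<tau> (x + y) 0 - \<tau> x 0)"
    using increment_lifts[OF compact_principal_system[of f] conn principal_system_zero
        principal_system_add principal_system_diff] by blast
  have "\<exists>k. continuous_on ?X k \<and> (\<forall>x\<in>?X. \<bar>k x\<bar> \<le> C \<and> abs_circle (k x) = (\<tau> (x + y) - \<tau> x) \<gamma>)" for \<gamma>
  proof -
    obtain k where k: "continuous_on ?X k" "\<And>x. x \<in> ?X \<Longrightarrow> \<bar>k x\<bar> \<le> C"
      "\<And>x. x \<in> ?X \<Longrightarrow> abs_circle (k x) = \<tau> (x + shift (- \<gamma>) y) 0 - \<tau> x 0"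
      using C[OF shift_principal_system[OF y]] by metis
    have "continuous_on ?X (\<lambda>x. k (shift (- \<gamma>) x))"
      by (rule continuous_on_compose2[OF k(1) continuous_on_subset[OF continuous_on_shift]])
        (auto intro: shift_principal_system)
    moreover have "abs_circle (k (shift (- \<gamma>) x)) = (\<tau> (x + y) - \<tau> x) \<gamma>" if "x \<in> ?X" for x
    proof -
      have "abs_circle (k (shift (- \<gamma>) x)) = \<tau> (shift (- \<gamma>) (x + y)) 0 - \<tau> (shift (- \<gamma>) x) 0"
        using k(3) shift_principal_system[OF that] by (simp add: shift_add_fun)
      also have "\<dots> = (\<tau> (x + y) - \<tau> x) \<gamma>"
        using \<tau>_shift that y by (simp add: principal_system_add) (simp add: shift_def)
      finally show ?thesis .
    qed
    moreover have "\<bar>k (shift (- \<gamma>) x)\<bar> \<le> C" if "x \<in> ?X" for x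
      using k(2) shift_principal_system[OF that] by blast
    ultimately show ?thesis by blast
  qed
  then obtain k where k_cont: "\<And>\<gamma>. continuous_on ?X (k \<gamma>)"
    and k_bound: "\<And>\<gamma> x. x \<in> ?X \<Longrightarrow> \<bar>k \<gamma> x\<bar> \<le> C"
    and k_lift: "\<And>\<gamma> x. x \<in> ?X \<Longrightarrow> abs_circle (k \<gamma> x) = (\<tau> (x + y) - \<tau> x) \<gamma>"
    by metis
  \<comment> \<open>Modulo 1, \<open>f\<close> applied to the lifts is \<open>f \<cdot> (\<tau> (x + y) - \<tau> x) = 0\<close>.\<close>
  have const: "(f \<star> (\<lambda>\<gamma>. k \<gamma> x)) \<gamma> = (f \<star> (\<lambda>\<gamma>. k \<gamma> 0)) \<gamma>" for \<gamma>
  proof (rule continuous_integer_valued_constant[OF conn _ _ x principal_system_zero])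
    show "continuous_on ?X (\<lambda>x. (f \<star> (\<lambda>\<gamma>. k \<gamma> x)) \<gamma>)"
      unfolding act_def real_scale_def by (intro continuous_intros k_cont)
    fix x assume x: "x \<in> ?X"
    have "proj (\<lambda>\<gamma>. k \<gamma> x) = \<tau> (x + y) - \<tau> x" using k_lift[OF x] by (auto simp: proj_def)
    then have "proj (f \<star> (\<lambda>\<gamma>. k \<gamma> x)) = 0"
      using \<tau>X x y principal_system_add principal_system_diff
      by (metis mem_principal_system proj_act)
    then show "(f \<star> (\<lambda>\<gamma>. k \<gamma> x)) \<gamma> \<in> \<int>" by (simp add: proj_eq_0_iff)
  qed
  have "(\<lambda>\<gamma>. k \<gamma> x) - (\<lambda>\<gamma>. k \<gamma> 0) = 0"
  proof (rule bounded_kernel)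
    show "\<bar>((\<lambda>\<gamma>. k \<gamma> x) - (\<lambda>\<gamma>. k \<gamma> 0)) \<gamma>\<bar> \<le> 2 * C" for \<gamma>
      using k_bound[OF x, of \<gamma>] k_bound[OF principal_system_zero, of \<gamma>] by simp
    show "f \<star> ((\<lambda>\<gamma>. k \<gamma> x) - (\<lambda>\<gamma>. k \<gamma> 0)) = 0"
      using const by (auto simp: real.act_diff)
  qed
  then have "k \<gamma> x = k \<gamma> 0" for \<gamma> by (simp add: fun_eq_iff)
  then have "(\<tau> (x + y) - \<tau> x) \<gamma> = (\<tau> (0 + y) - \<tau> 0) \<gamma>" for \<gamma>
    using k_lift[OF x] k_lift[OF principal_system_zero] by metis
  then have "\<tau> (x + y) - \<tau> x = \<tau> y - \<tau> 0" by (metis add_0 ext)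
  then show ?thesis by (simp add: algebra_simps)
qed

section \<open>Homoclinic points\<close>

text \<open>The point \<open>proj w\<close> is the fundamental homoclinic point of the system.\<close>

locale fundamental_homoclinic = bounded_injective f for f :: "'g::{ab_group_add, countable} \<Rightarrow>\<^sub>0 int" +
  fixes w :: "'g \<Rightarrow> real"
  assumes w_vanishing: "vanishing w" and w_bounded: "bounded (range w)" and act_w: "f \<star> w = delta"
begin

lemma act_act_w: "f \<star> g \<star> w = g \<star> delta"
  by (simp add: real.act_commute[of f g] act_w)

lemma act_proj_w_mem: "g \<cdot> proj w \<in> principal_system f"
proof -
  have "f \<cdot> proj w = proj delta" by (simp add: act_w flip: proj_act)
  also have "\<dots> = 0" by (simp add: proj_eq_0_iff)
  finally have "proj w \<in> principal_system f" by (simp add: mem_principal_system)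
  then show ?thesis by (rule principal_system_act)
qed

lemma bounded_act_w: obtains M where "\<And>\<gamma>. \<bar>(g \<star> w) \<gamma>\<bar> \<le> M"
proof -
  obtain M where "\<And>\<gamma>. \<bar>w \<gamma>\<bar> \<le> M" using w_bounded by (auto simp: bounded_iff)
  then show thesis using bounded_act that by blast
qed

text \<open>If \<open>v\<close> is a lift of \<open>x\<close> tending to zero, then \<open>f \<star> v\<close> is integer-valued and tends to zero, hence
  is finitely supported and given by some \<open>g\<close>; then \<open>v\<close> and \<open>g \<star> w\<close> have the same image under \<open>f\<close>.\<close>

lemma vanishing_point_eq_act:
  assumes "x \<in> principal_system f" "vanishing x"
  obtains g where "x = g \<cdot> proj w"
proof -
  define v where "v = (\<lambda>\<gamma>. small_rep (x \<gamma>))"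
  have x: "proj v = x" by (simp add: v_def)
  have "vanishing v" using assms(2) by (simp add: vanishing_def v_def abs_small_rep)
  then have "vanishing (f \<star> v)" by (rule vanishing_real_act)
  moreover have int: "(f \<star> v) \<gamma> \<in> \<int>" for \<gamma>
    using assms(1) x proj_eq_0_iff[of "f \<star> v"] by (simp add: proj_act mem_principal_system)
  ultimately have "finite {\<gamma>. (f \<star> v) \<gamma> \<noteq> 0}" by (rule vanishing_integer_valued_finite)
  then obtain g where g: "g \<star> delta = f \<star> v"
    using integer_valued_eq_act_delta int by blast
  obtain M where M: "\<And>\<gamma>. \<bar>(g \<star> w) \<gamma>\<bar> \<le> M" using bounded_act_w by blast
  have "v - g \<star> w = 0"
  proof (rule bounded_kernel)
    show "\<bar>(v - g \<star> w) \<gamma>\<bar> \<le> 1 + M" for \<gamma>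
      using M[of \<gamma>] abs_small_rep_le[of "x \<gamma>"] unfolding v_def by simp
    show "f \<star> (v - g \<star> w) = 0" by (simp add: real.act_diff act_act_w g)
  qed
  then have "v = g \<star> w" by simp
  then have "x = g \<cdot> proj w" using x by (simp add: proj_act)
  then show thesis by (rule that)
qed

text \<open>Here \<open>g \<star> w\<close> is integer-valued and tends to zero, hence it is the configuration of some \<open>h\<close>, and
  applying \<open>f\<close> recovers \<open>g\<close>.\<close>

lemma act_proj_w_eq_0:
  assumes "g \<cdot> proj w = 0"
  obtains h where "g = h * f"
proof -
  have int: "(g \<star> w) \<gamma> \<in> \<int>" for \<gamma>
    using assms proj_eq_0_iff[of "g \<star> w"] by (simp add: proj_act)
  then have "finite {\<gamma>. (g \<star> w) \<gamma> \<noteq> 0}"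
    using vanishing_integer_valued_finite vanishing_real_act[OF w_vanishing] by blast
  then obtain h where h: "h \<star> delta = g \<star> w"
    using integer_valued_eq_act_delta int by blast
  have "g \<star> delta = f \<star> h \<star> delta" unfolding h by (simp add: act_act_w)
  also have "\<dots> = (h * f) \<star> delta" by (simp add: real.act_mult real.act_commute[of f h])
  finally have "of_int (Poly_Mapping.lookup g (- \<gamma>)) = (of_int (Poly_Mapping.lookup (h * f) (- \<gamma>)) :: real)" for \<gamma>
    by (metis act_delta)
  then have "Poly_Mapping.lookup g \<gamma> = Poly_Mapping.lookup (h * f) \<gamma>" for \<gamma>
    by (metis minus_minus of_int_eq_iff)
  then have "g = h * f" by (rule poly_mapping_eqI)
  then show thesis by (rule that)
qed

text \<open>Lift \<open>x\<close> to a bounded \<open>v\<close>, so that \<open>a = f \<star> v\<close> is integer-valued, and cut \<open>a\<close> off outside a large finite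
  set to get \<open>g\<close>. The cut-offs have a common bound, hence so do the \<open>g \<star> w\<close>, and the local estimate
  compares \<open>g \<star> w\<close> with \<open>v\<close> wherever their images under \<open>f\<close> agree nearby.\<close>

lemma act_proj_w_dense:
  assumes x: "x \<in> principal_system f" and "finite F" "\<epsilon> > 0"
  obtains g where "\<And>\<gamma>. \<gamma> \<in> F \<Longrightarrow> dist ((g \<cdot> proj w) \<gamma>) (x \<gamma>) < \<epsilon>"
proof -
  define v where "v = (\<lambda>\<gamma>. small_rep (x \<gamma>))"
  have projv: "proj v = x" by (simp add: v_def)
  have v1: "\<bar>v \<gamma>\<bar> \<le> 1" for \<gamma> by (simp add: v_def abs_small_rep_le)
  define a where "a = f \<star> v"
  have int: "a \<gamma> \<in> \<int>" for \<gamma>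
    using x projv proj_eq_0_iff[of a] by (simp add: proj_act mem_principal_system a_def)
  obtain B where B: "\<And>\<gamma>. \<bar>a \<gamma>\<bar> \<le> B" unfolding a_def using bounded_act[of v 1 f, OF v1] by blast
  obtain C where "C > 0" and
    below: "\<And>v M B \<beta>. (\<And>\<gamma>. \<bar>v \<gamma>\<bar> \<le> M) \<Longrightarrow> (\<And>\<gamma>. \<bar>(f \<star> v) \<gamma>\<bar> \<le> B) \<Longrightarrow> \<bar>v \<beta>\<bar> \<le> C * B"
    using bounded_below by metis
  obtain E c where "finite E" "c > 0" and
    ctl: "\<And>v \<beta>. (\<And>\<gamma>. \<bar>v \<gamma>\<bar> \<le> C * B + 1) \<Longrightarrow>
      (\<And>\<gamma>. \<gamma> \<in> E \<Longrightarrow> \<bar>(f \<star> v) (\<beta> + \<gamma>)\<bar> < c) \<Longrightarrow> \<bar>v \<beta>\<bar> < \<epsilon>"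
    using local_control_at[OF \<open>\<epsilon> > 0\<close>] by metis
  define P where "P = (\<lambda>(\<beta>, \<gamma>). \<beta> + \<gamma>) ` (F \<times> E)"
  have "finite P" using \<open>finite F\<close> \<open>finite E\<close> by (simp add: P_def)
  define b where "b = (\<lambda>\<gamma>. if \<gamma> \<in> P then a \<gamma> else 0)"
  have "finite {\<gamma>. b \<gamma> \<noteq> 0}"
    by (rule finite_subset[OF _ \<open>finite P\<close>]) (auto simp: b_def)
  moreover have "b \<gamma> \<in> \<int>" for \<gamma> using int by (simp add: b_def)
  ultimately obtain g where g: "g \<star> delta = b"
    using integer_valued_eq_act_delta by blast
  have fgw: "f \<star> g \<star> w = b" by (simp add: act_act_w g)
  have gw: "\<bar>(g \<star> w) \<gamma>\<bar> \<le> C * B" for \<gamma>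
  proof -
    obtain M where "\<And>\<gamma>. \<bar>(g \<star> w) \<gamma>\<bar> \<le> M" using bounded_act_w by blast
    then show ?thesis
    proof (rule below)
      show "\<bar>(f \<star> g \<star> w) \<gamma>\<bar> \<le> B" for \<gamma>
        using B[of \<gamma>] unfolding fgw b_def by (auto intro: order_trans[OF abs_ge_zero])
    qed
  qed
  have "dist ((g \<cdot> proj w) \<beta>) (x \<beta>) < \<epsilon>" if "\<beta> \<in> F" for \<beta>
  proof -
    have "\<bar>(g \<star> w - v) \<beta>\<bar> < \<epsilon>"
    proof (rule ctl)
      show "\<bar>(g \<star> w - v) \<gamma>\<bar> \<le> C * B + 1" for \<gamma>
        using gw[of \<gamma>] v1[of \<gamma>] by simp
      fix \<gamma> assume "\<gamma> \<in> E"
      then have "\<beta> + \<gamma> \<in> P" using that unfolding P_def by force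
      then have "(f \<star> (g \<star> w - v)) (\<beta> + \<gamma>) = 0"
        by (simp add: real.act_diff fgw b_def flip: a_def)
      then show "\<bar>(f \<star> (g \<star> w - v)) (\<beta> + \<gamma>)\<bar> < c" using \<open>c > 0\<close> by simp
    qed
    moreover have "dist ((g \<cdot> proj w) \<beta>) (x \<beta>) \<le> \<bar>(g \<star> w) \<beta> - v \<beta>\<bar>"
      using dist_abs_circle_le[of "(g \<star> w) \<beta>" "v \<beta>"]
      by (metis proj_act proj_def projv)
    ultimately show ?thesis by simp
  qed
  then show thesis by (rule that)
qed

end

section \<open>Surjectivity against injectivity on homoclinic points\<close>

lemma continuous_on_torus_act: "continuous_on A (\<lambda>x. g \<cdot> x)"
  unfolding act_def
  by (intro continuous_on_coordinatewise_then_product continuous_on_sum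
      continuous_on_compose2[OF continuous_on_int_scale[of UNIV]]
      continuous_on_subset[OF continuous_on_product_coordinates]) auto

text \<open>For fixed \<open>\<gamma>\<close> the left side is an additive function of \<open>g\<close>, hence determined by its values on group
  elements, where equivariance computes it.\<close>

lemma additive_equivariant_act:
  fixes f :: "'g::ab_group_add \<Rightarrow>\<^sub>0 int"
  assumes add: "\<And>x y. x \<in> principal_system f \<Longrightarrow> y \<in> principal_system f \<Longrightarrow> \<theta> (x + y) = \<theta> x + \<theta> y"
    and shift: "\<And>\<gamma> x. x \<in> principal_system f \<Longrightarrow> \<theta> (shift \<gamma> x) = shift \<gamma> (\<theta> x)"
    and x: "x \<in> principal_system f"
  shows "\<theta> (g \<cdot> x) = g \<cdot> \<theta> x"
proof
  fix \<gamma>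
  have single: "Poly_Mapping.single a 1 \<cdot> x = shift (- a) x" for a
    by (rule ext) (simp add: circle.act_single shift_def add.commute)
  have "\<theta> ((a + b) \<cdot> x) = \<theta> (a \<cdot> x) + \<theta> (b \<cdot> x)" for a b
    unfolding circle.act_add_left by (intro add principal_system_act x)
  then have "\<theta> (g \<cdot> x) \<gamma> = pairing g (\<lambda>a. \<theta> (Poly_Mapping.single a 1 \<cdot> x) \<gamma>)"
    by (intro additive_eq_pairing) simp
  also have "\<dots> = (g \<cdot> \<theta> x) \<gamma>"
    unfolding single shift[OF x] by (simp add: pairing_def act_def shift_def add.commute)
  finally show "\<theta> (g \<cdot> x) \<gamma> = (g \<cdot> \<theta> x) \<gamma>" .
qed

lemma homoclinic_image:
  fixes \<theta> :: "('g::{ab_group_add, countable} \<Rightarrow> circle) \<Rightarrow> 'g \<Rightarrow> circle"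
  assumes "continuous_on X \<theta>" "0 \<in> X" "\<theta> 0 = 0"
    and inv: "\<And>\<gamma>. shift \<gamma> z \<in> X" and shift: "\<And>\<gamma>. \<theta> (shift \<gamma> z) = shift \<gamma> (\<theta> z)"
    and h: "homoclinic dist shift z 0"
  shows "homoclinic dist shift (\<theta> z) 0"
  unfolding homoclinic_def
proof (intro allI impI)
  fix \<epsilon> :: real assume "0 < \<epsilon>"
  then obtain \<delta> where "\<delta> > 0" and \<delta>: "\<And>x. x \<in> X \<Longrightarrow> dist x 0 < \<delta> \<Longrightarrow> dist (\<theta> x) (\<theta> 0) < \<epsilon>"
    using assms(1,2) unfolding continuous_on_iff by metis
  then obtain F where "finite F" "\<And>\<gamma>. \<gamma> \<notin> F \<Longrightarrow> dist (shift \<gamma> z) (shift \<gamma> 0) < \<delta>"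
    using h unfolding homoclinic_def by metis
  then show "\<exists>F. finite F \<and> (\<forall>\<gamma>. \<gamma> \<notin> F \<longrightarrow> dist (shift \<gamma> (\<theta> z)) (shift \<gamma> 0) < \<epsilon>)"
    using \<delta>[OF inv] by (intro exI[of _ F]) (simp add: shift \<open>\<theta> 0 = 0\<close>)
qed

context fundamental_homoclinic
begin

lemma proj_w_mem: "proj w \<in> principal_system f"
  using act_proj_w_mem[of 1] by (simp add: act_def)

lemma principal_system_subset_closure:
  "principal_system f \<subseteq> closure (range (\<lambda>g. g \<cdot> proj w))"
proof
  fix x assume x: "x \<in> principal_system f"
  show "x \<in> closure (range (\<lambda>g. g \<cdot> proj w))"
    unfolding closure_approachable
  proof (intro allI impI)
    fix \<epsilon> :: real assume "0 < \<epsilon>"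
    then obtain F \<delta> where "finite F" "\<delta> > 0" and
      \<delta>: "\<And>x y :: 'g \<Rightarrow> circle. (\<And>\<eta>. \<eta> \<in> F \<Longrightarrow> dist (x \<eta>) (y \<eta>) < \<delta>) \<Longrightarrow> dist x y < \<epsilon>"
      using dist_fun_small by metis
    obtain g where "\<And>\<gamma>. \<gamma> \<in> F \<Longrightarrow> dist ((g \<cdot> proj w) \<gamma>) (x \<gamma>) < \<delta>"
      using act_proj_w_dense[OF x \<open>finite F\<close> \<open>\<delta> > 0\<close>] by blast
    then have "dist (g \<cdot> proj w) x < \<epsilon>" by (rule \<delta>)
    then show "\<exists>y\<in>range (\<lambda>g. g \<cdot> proj w). dist y x < \<epsilon>" by blast
  qed
qed

text \<open>Density of the homoclinic points, in the form in which it is used.\<close>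

lemma eq_on_principal_system:
  fixes A B :: "('g \<Rightarrow> circle) \<Rightarrow> 'g \<Rightarrow> circle"
  assumes "continuous_on (principal_system f) A" "continuous_on (principal_system f) B"
    and eq: "\<And>g. A (g \<cdot> proj w) = B (g \<cdot> proj w)" and x: "x \<in> principal_system f"
  shows "A x = B x"
proof -
  let ?X = "principal_system f"
  have "continuous_on ?X (\<lambda>x. A x \<gamma> - B x \<gamma>)" for \<gamma>
    by (intro continuous_intros assms(1,2)[THEN continuous_on_product_then_coordinatewise])
  then have "continuous_on ?X (\<lambda>x. A x - B x)"
    by (intro continuous_on_coordinatewise_then_product) simp
  then have "closed (?X \<inter> (\<lambda>x. A x - B x) -` {0})"
    by (rule continuous_closed_preimage) (simp_all add: compact_imp_closed compact_principal_system)
  moreover have "range (\<lambda>g. g \<cdot> proj w) \<subseteq> ?X \<inter> (\<lambda>x. A x - B x) -` {0}"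
    using eq act_proj_w_mem by auto
  ultimately have "closure (range (\<lambda>g. g \<cdot> proj w)) \<subseteq> ?X \<inter> (\<lambda>x. A x - B x) -` {0}"
    by (intro closure_minimal)
  then show ?thesis using principal_system_subset_closure x by auto
qed

text \<open>Since \<open>\<theta>\<close> preserves homoclinicity to \<open>0\<close>, it maps \<open>proj w\<close> to some \<open>r \<cdot> proj w\<close>; equivariance and density do
  the rest.\<close>

lemma continuous_endomorphism_eq_act:
  assumes cont: "continuous_on (principal_system f) \<theta>"
    and maps: "\<And>x. x \<in> principal_system f \<Longrightarrow> \<theta> x \<in> principal_system f"
    and add: "\<And>x y. x \<in> principal_system f \<Longrightarrow> y \<in> principal_system f \<Longrightarrow> \<theta> (x + y) = \<theta> x + \<theta> y"
    and shift: "\<And>\<gamma> x. x \<in> principal_system f \<Longrightarrow> \<theta> (shift \<gamma> x) = shift \<gamma> (\<theta> x)"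
  obtains r where "\<And>x. x \<in> principal_system f \<Longrightarrow> \<theta> x = r \<cdot> x"
proof -
  let ?X = "principal_system f"
  have vanishing_iff: "homoclinic dist shift x 0 \<longleftrightarrow> vanishing x" if "x \<in> ?X" for x
    using homoclinic_iff_vanishing[OF compatible_metric_dist that principal_system_zero] by simp
  have "\<theta> 0 = 0" using add[OF principal_system_zero principal_system_zero] by simp
  have "vanishing (proj w)" using w_vanishing by (rule vanishing_proj)
  then have "homoclinic dist shift (proj w) 0" using vanishing_iff[OF proj_w_mem] by simp
  then have "homoclinic dist shift (\<theta> (proj w)) 0"
    by (intro homoclinic_image[OF cont principal_system_zero \<open>\<theta> 0 = 0\<close>] shift
        shift_principal_system proj_w_mem)
  then have "vanishing (\<theta> (proj w))" using vanishing_iff[OF maps[OF proj_w_mem]] by simp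
  then obtain r where r: "\<theta> (proj w) = r \<cdot> proj w"
    using vanishing_point_eq_act maps proj_w_mem by blast
  have "\<theta> (g \<cdot> proj w) = r \<cdot> g \<cdot> proj w" for g
    using additive_equivariant_act[OF add shift proj_w_mem] r by (simp add: circle.act_commute[of g])
  then have "\<theta> x = r \<cdot> x" if "x \<in> ?X" for x
    by (rule eq_on_principal_system[OF cont continuous_on_torus_act _ that])
  then show thesis by (rule that)
qed

text \<open>If \<open>z = g \<cdot> proj w\<close>, then \<open>r * g\<close> kills \<open>proj w\<close>, hence everything by density; writing \<open>proj w = r \<cdot> u\<close>
  turns \<open>z\<close> into \<open>r \<cdot> g \<cdot> u\<close>.\<close>

lemma act_surjective_imp_injective_on_vanishing:
  assumes surj: "(\<lambda>x. r \<cdot> x) ` principal_system f = principal_system f"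
    and z: "z \<in> principal_system f" "vanishing z" and rz: "r \<cdot> z = 0"
  shows "z = 0"
proof -
  obtain g where g: "z = g \<cdot> proj w" using vanishing_point_eq_act[OF z] .
  have zero: "r \<cdot> g \<cdot> x = 0" if "x \<in> principal_system f" for x
  proof (rule eq_on_principal_system[OF _ _ _ that])
    show "continuous_on (principal_system f) (\<lambda>x. r \<cdot> g \<cdot> x)"
      unfolding circle.act_mult[symmetric] by (rule continuous_on_torus_act)
    show "continuous_on (principal_system f) (\<lambda>x. 0)" by (rule continuous_on_const)
    show "r \<cdot> g \<cdot> h \<cdot> proj w = 0" for h
      using rz unfolding g by (metis circle.act_commute circle.act_zero)
  qed
  obtain u where "u \<in> principal_system f" "proj w = r \<cdot> u"
    using surj proj_w_mem by (metis imageE)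
  then show ?thesis using zero[of u] by (simp add: g circle.act_commute[of g r])
qed

text \<open>The assumption makes multiplication by \<open>r\<close> injective modulo \<open>f\<close>, so \<open>r * g + h * f \<mapsto> pairing g x\<close> is a
  well-defined character on the ideal generated by \<open>r\<close> and \<open>f\<close>. The values of an extension at the group elements form
  a preimage of \<open>x\<close>.\<close>

lemma act_injective_on_vanishing_imp_surjective:
  assumes inj: "\<And>g. r \<cdot> g \<cdot> proj w = 0 \<Longrightarrow> g \<cdot> proj w = 0"
    and x: "x \<in> principal_system f"
  obtains y where "y \<in> principal_system f" "r \<cdot> y = x"
proof -
  define H where "H = {r * g + h * f | g h. True}"
  define \<psi> where "\<psi> m = pairing (SOME g. \<exists>h. m = r * g + h * f) x" for m
  have \<psi>: "\<psi> (r * g + h * f) = pairing g x" for g h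
  proof -
    define g' where "g' = (SOME g'. \<exists>h'. r * g + h * f = r * g' + h' * f)"
    have "\<exists>h'. r * g + h * f = r * g' + h' * f"
      unfolding g'_def by (rule someI_ex) blast
    then obtain h' where h': "r * g + h * f = r * g' + h' * f" by blast
    then have "r * (g' - g) = (h - h') * f" by (simp add: algebra_simps)
    then have "r \<cdot> (g' - g) \<cdot> proj w = (h - h') \<cdot> f \<cdot> proj w" by (metis circle.act_mult)
    also have "\<dots> = 0" using proj_w_mem by (simp add: mem_principal_system)
    finally have "(g' - g) \<cdot> proj w = 0" by (rule inj)
    then obtain k where "g' - g = k * f" by (rule act_proj_w_eq_0)
    then have "g' = g + k * f" by (simp add: algebra_simps)
    then have "pairing g' x = pairing g x" using x by (simp add: pairing_add principal_system_iff)
    then show ?thesis by (simp add: \<psi>_def g'_def)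
  qed
  have pairing_diff: "pairing (a - b) x = pairing a x - pairing b x" for a b
    using pairing_add[of "a - b" b x] by simp
  have "module (\<lambda>n (m :: 'g \<Rightarrow>\<^sub>0 int). of_int n * m)"
    by standard (simp_all add: algebra_simps)
  then obtain \<Psi> where \<Psi>: "\<And>a b. \<Psi> (a + b) = \<Psi> a + \<Psi> b" "\<And>a. a \<in> H \<Longrightarrow> \<Psi> a = \<psi> a"
  proof (rule extend_circle_character[where H = H and \<psi> = \<psi>])
    show "H \<noteq> {}" by (auto simp: H_def)
    fix a b assume "a \<in> H" "b \<in> H"
    then obtain g h g' h' where ab: "a = r * g + h * f" "b = r * g' + h' * f" by (auto simp: H_def)
    then have eq: "a - b = r * (g - g') + (h - h') * f" by (simp add: algebra_simps)
    then show "a - b \<in> H" unfolding H_def by blast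
    have "\<psi> (a - b) = pairing (g - g') x" unfolding eq by (rule \<psi>)
    moreover have "\<psi> a = pairing g x" "\<psi> b = pairing g' x" unfolding ab by (rule \<psi>)+
    ultimately show "\<psi> (a - b) = \<psi> a - \<psi> b" by (simp add: pairing_diff)
  qed blast
  define y where "y = (\<lambda>\<gamma>. \<Psi> (Poly_Mapping.single \<gamma> 1))"
  have y: "\<Psi> g = pairing g y" for g unfolding y_def by (rule additive_eq_pairing) (rule \<Psi>(1))
  have \<Psi>H: "\<Psi> (r * g + h * f) = pairing g x" for g h
  proof -
    have "r * g + h * f \<in> H" unfolding H_def by blast
    then show ?thesis using \<Psi>(2) \<psi> by simp
  qed
  show thesis
  proof
    show "y \<in> principal_system f"
      unfolding principal_system_iff
    proof
      fix g
      have "pairing 0 x = 0" by (simp add: pairing_def)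
      then show "pairing (g * f) y = 0" using \<Psi>H[of 0 g] by (simp add: y[symmetric])
    qed
    show "r \<cdot> y = x"
    proof
      fix \<gamma>
      have "(r \<cdot> y) \<gamma> = pairing (Poly_Mapping.single \<gamma> 1 * r) y"
        by (simp add: pairing_eq_act circle.act_mult circle.act_single)
      also have "\<dots> = x \<gamma>"
        using \<Psi>H[of "Poly_Mapping.single \<gamma> 1" 0] by (simp add: y[symmetric] mult.commute pairing_single)
      finally show "(r \<cdot> y) \<gamma> = x \<gamma>" .
    qed
  qed
qed

end

theorem theorem1p1:
  fixes f :: "'g :: {ab_group_add, countable} \<Rightarrow>\<^sub>0 int"
    and d :: "('g \<Rightarrow> circle) \<Rightarrow> ('g \<Rightarrow> circle) \<Rightarrow> real"
  assumes "compatible_metric (principal_system f) d"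
    and "expansive (principal_system f) d shift"
    and "connected (principal_system f)"
  shows "Moore_Myhill_property (principal_system f) d shift"
proof -
  let ?X = "principal_system f"
  have "bounded_injective f" using assms by (intro expansive_imp_bounded_injective)
  then interpret bounded_injective f .
  obtain w where "vanishing w" "f \<star> w = delta" "bounded (range w)" by (rule fundamental_solution)
  then interpret fundamental_homoclinic f w by unfold_locales
  note homoclinic_iff = homoclinic_iff_vanishing[OF assms(1)]
  have reduce: "\<exists>r. \<forall>x\<in>?X. \<tau> x = r \<cdot> x + \<tau> 0" and fixed: "\<tau> 0 \<in> ?X"
    if \<tau>: "endomorphism ?X shift \<tau>" for \<tau>
  proof -
    have maps: "\<tau> x \<in> ?X" if "x \<in> ?X" for x using \<tau> that by (auto simp: endomorphism_def)
    have shift: "\<tau> (shift \<gamma> x) = shift \<gamma> (\<tau> x)" if "x \<in> ?X" for \<gamma> x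
      using \<tau> that by (simp add: endomorphism_def)
    have cont: "continuous_on ?X \<tau>" using \<tau> by (simp add: endomorphism_def)
    show "\<tau> 0 \<in> ?X" by (intro maps principal_system_zero)
    define \<theta> where "\<theta> x = \<tau> x - \<tau> 0" for x
    obtain r where "\<And>x. x \<in> ?X \<Longrightarrow> \<theta> x = r \<cdot> x"
    proof (rule continuous_endomorphism_eq_act[of \<theta>])
      have "continuous_on ?X (\<lambda>x. \<tau> x \<gamma> - \<tau> 0 \<gamma>)" for \<gamma>
        by (intro continuous_intros continuous_on_product_then_coordinatewise[OF cont])
      then show "continuous_on ?X \<theta>"
        unfolding \<theta>_def by (intro continuous_on_coordinatewise_then_product) simp
      show "\<theta> x \<in> ?X" if "x \<in> ?X" for x
        unfolding \<theta>_def by (intro principal_system_diff maps that principal_system_zero)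
      show "\<theta> (x + y) = \<theta> x + \<theta> y" if "x \<in> ?X" "y \<in> ?X" for x y
        using endomorphism_affine[OF bounded_injective_axioms assms(3) \<tau> that]
        by (simp add: \<theta>_def algebra_simps)
      show "\<theta> (shift \<gamma> x) = shift \<gamma> (\<theta> x)" if "x \<in> ?X" for \<gamma> x
        using shift[OF that] shift[OF principal_system_zero, of \<gamma>]
        by (simp add: \<theta>_def shift_diff_fun)
    qed blast
    then have "\<forall>x\<in>?X. \<tau> x = r \<cdot> x + \<tau> 0" by (simp add: \<theta>_def algebra_simps)
    then show "\<exists>r. \<forall>x\<in>?X. \<tau> x = r \<cdot> x + \<tau> 0" by blast
  qed
  have "pre_injective ?X d shift \<tau>" if \<tau>: "endomorphism ?X shift \<tau>" and surj: "\<tau> ` ?X = ?X" for \<tau>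
    unfolding pre_injective_def
  proof (intro ballI inj_onI)
    fix x y y'
    assume x: "x \<in> ?X" and "y \<in> {y \<in> ?X. homoclinic d shift x y}"
      and "y' \<in> {y \<in> ?X. homoclinic d shift x y}" and eq: "\<tau> y = \<tau> y'"
    then have y: "y \<in> ?X" "vanishing (x - y)" and y': "y' \<in> ?X" "vanishing (x - y')"
      using homoclinic_iff[OF x] by auto
    obtain r where r: "\<And>x. x \<in> ?X \<Longrightarrow> \<tau> x = r \<cdot> x + \<tau> 0" using reduce[OF \<tau>] by blast
    have "y - y' = 0"
    proof (rule act_surjective_imp_injective_on_vanishing)
      show "(\<lambda>x. r \<cdot> x) ` ?X = ?X"
      proof (intro equalityI subsetI)
        fix x assume "x \<in> ?X"
        then have "x + \<tau> 0 \<in> \<tau> ` ?X" unfolding surj by (intro principal_system_add fixed[OF \<tau>])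
        then obtain u where "u \<in> ?X" "x + \<tau> 0 = \<tau> u" by blast
        then show "x \<in> (\<lambda>x. r \<cdot> x) ` ?X" using r by simp
      qed (auto intro: principal_system_act)
      show "y - y' \<in> ?X" using y(1) y'(1) by (rule principal_system_diff)
      show "vanishing (y - y')" using vanishing_diff[OF y'(2) y(2)] by simp
      show "r \<cdot> (y - y') = 0" using eq r[OF y(1)] r[OF y'(1)] by (simp add: circle.act_diff)
    qed
    then show "y = y'" by simp
  qed
  moreover have "\<tau> ` ?X = ?X" if \<tau>: "endomorphism ?X shift \<tau>" and inj: "pre_injective ?X d shift \<tau>" for \<tau>
  proof (intro equalityI subsetI)
    obtain r where r: "\<And>x. x \<in> ?X \<Longrightarrow> \<tau> x = r \<cdot> x + \<tau> 0" using reduce[OF \<tau>] by blast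
    have inj_r: "g \<cdot> proj w = 0" if "r \<cdot> g \<cdot> proj w = 0" for g
    proof -
      let ?z = "g \<cdot> proj w"
      have z: "?z \<in> ?X" by (rule act_proj_w_mem)
      have "vanishing ?z"
        unfolding proj_act[symmetric] by (intro vanishing_proj vanishing_real_act w_vanishing)
      then have "homoclinic d shift ?z 0" "homoclinic d shift ?z ?z"
        using vanishing_diff[of ?z ?z] by (simp_all add: homoclinic_iff z principal_system_zero)
      moreover have "\<tau> ?z = \<tau> 0" using r[OF z] that by simp
      moreover have "inj_on \<tau> {y \<in> ?X. homoclinic d shift ?z y}"
        using inj z unfolding pre_injective_def by blast
      ultimately show "?z = 0" using z principal_system_zero[of f] inj_onD[of \<tau> _ ?z 0] by blast
    qed
    fix x assume "x \<in> ?X"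
    then have "x - \<tau> 0 \<in> ?X" by (intro principal_system_diff fixed[OF \<tau>])
    then obtain y where "y \<in> ?X" "r \<cdot> y = x - \<tau> 0"
      using act_injective_on_vanishing_imp_surjective[OF inj_r] by blast
    then have "\<tau> y = x" using r by simp
    then show "x \<in> \<tau> ` ?X" using \<open>y \<in> ?X\<close> by blast
  next
    fix x assume "x \<in> \<tau> ` ?X"
    then show "x \<in> ?X" using \<tau> by (auto simp: endomorphism_def)
  qed
  ultimately show ?thesis
    by (simp add: Moore_Myhill_property_def Moore_property_def Myhill_property_def)
qed

end
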